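(* Let $(\Omega,\mathsf F,\mathfrak m_{BH})$ be an $n$-dimensional Funk metric space endowed with the Busemann--Hausdorff measure. Then: (i) $W^{1,p}_0(\Omega,\mathsf F,\mathfrak m_{BH})$ is not a vector space for each $p\in(1,+\infty)$; (ii) for each $p\in(1,+\infty)$ the forward and backward topologies of $W^{1,p}_0(\Omega,\mathsf F,\mathfrak m_{BH})$ are incompatible; in particular there exist a sequence $(u_k)$ and $u$ in $W^{1,p}_0(\Omega,\mathsf F,\mathfrak m_{BH})$ with $\lim_{k\to\infty}\|u-u_k\|_{W^{1,p}_{\mathfrak m_{BH}}}=0$ and $\|u_k-u\|_{W^{1,p}_{\mathfrak m_{BH}}}=+\infty$ for all $k\in\mathbb N$.
   Context: A Funk metric space is a pair $(\Omega,\mathsf F)$ with $\Omega\subset\mathbb R^n$ ($n\ge2$) a bounded domain and $\mathsf F$ a Finsler metric on $\Omega$ satisfying $x+y/\mathsf F(x,y)\in\partial\Omega$ for all $x\in\Omega$, $y\neq0$. Busemann--Hausdorff measure: $d\mathfrak m_{BH}=\frac{\omega_n}{\mathrm{vol}(B_x)}dx$, $B_x=\{y:\mathsf F(x,y)<1\}$, $\omega_n$ the volume of the Euclidean unit ball. Co-metric $\mathsf F^*(x,\eta)=\sup_{y\ne0}\eta(y)/\mathsf F(x,y)$. $\|u\|_{W^{1,p}_{\mathfrak m}}=(\int|u|^pd\mathfrak m)^{1/p}+(\int\mathsf F^{*p}(du)d\mathfrak m)^{1/p}$ (possibly $+\infty$), and $W^{1,p}_0(\Omega,\mathsf F,\mathfrak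 m)$ is the set of $u$ with $\|u-u_k\|_{W^{1,p}_{\mathfrak m}}\to0$ for some $u_k\in C^\infty_0(\Omega)$. With $\mathsf D_p(u,v)=\|v-u\|_{W^{1,p}_{\mathfrak m}}$, the forward topology is generated by the balls $\{v:\mathsf D_p(u,v)<R\}$, the backward topology by $\{v:\mathsf D_p(v,u)<R\}$. *)

theory Defs
  imports "HOL-Analysis.Analysis"
begin

fun iter_dderiv :: "('a::real_normed_vector \<Rightarrow> real) \<Rightarrow> 'a list \<Rightarrow> 'a \<Rightarrow> real" where
  "iter_dderiv f [] = f"
| "iter_dderiv f (v # vs) = (\<lambda>x. frechet_derivative (iter_dderiv f vs) (at x) v)"

text \<open>C-infinity on an open set: all iterated derivatives exist (hence are continuous).\<close>
definition smooth_on :: "'a::real_normed_vector set \<Rightarrow> ('a \<Rightarrow> real) \<Rightarrow> bool" where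
  "smooth_on S f \<longleftrightarrow> (\<forall>vs. \<forall>x\<in>S. iter_dderiv f vs differentiable (at x))"

definition Cc_inf :: "'a::euclidean_space set \<Rightarrow> ('a \<Rightarrow> real) set" where
  "Cc_inf \<Omega> = {\<phi>. smooth_on UNIV \<phi> \<and> compact (closure {x. \<phi> x \<noteq> 0})
                      \<and> closure {x. \<phi> x \<noteq> 0} \<subseteq> \<Omega>}"

definition finsler_metric :: "'a::euclidean_space set \<Rightarrow> ('a \<Rightarrow> 'a \<Rightarrow> real) \<Rightarrow> bool" where
  "finsler_metric \<Omega> F \<longleftrightarrow>
     smooth_on (\<Omega> \<times> (UNIV - {0})) (\<lambda>(x, y). F x y)
   \<and> (\<forall>x\<in>\<Omega>. \<forall>y. y \<noteq> 0 \<longrightarrow> F x y > 0)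
   \<and> (\<forall>x\<in>\<Omega>. \<forall>y. \<forall>c::real. c > 0 \<longrightarrow> F x (c *\<^sub>R y) = c * F x y)
   \<and> (\<forall>x\<in>\<Omega>. \<forall>y v. y \<noteq> 0 \<longrightarrow> v \<noteq> 0 \<longrightarrow>
         deriv (deriv (\<lambda>t. (F x (y + t *\<^sub>R v))\<^sup>2)) 0 > 0)"

definition bounded_domain :: "'a::euclidean_space set \<Rightarrow> bool" where
  "bounded_domain \<Omega> \<longleftrightarrow> open \<Omega> \<and> connected \<Omega> \<and> bounded \<Omega> \<and> \<Omega> \<noteq> {}"

definition funk_metric_space :: "'a::euclidean_space set \<Rightarrow> ('a \<Rightarrow> 'a \<Rightarrow> real) \<Rightarrow> bool" where
  "funk_metric_space \<Omega> F \<longleftrightarrow> bounded_domain \<Omega> \<and> finsler_metric \<Omega> F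
     \<and> (\<forall>x\<in>\<Omega>. \<forall>y. y \<noteq> 0 \<longrightarrow> x + (1 / F x y) *\<^sub>R y \<in> frontier \<Omega>)"

definition BH_measure :: "'a::euclidean_space set \<Rightarrow> ('a \<Rightarrow> 'a \<Rightarrow> real) \<Rightarrow> 'a measure" where
  "BH_measure \<Omega> F = density lborel (\<lambda>x. indicator \<Omega> x *
      ennreal (measure lborel (ball (0::'a) 1) / measure lborel {y. F x y < 1}))"

text \<open>Co-metric evaluated on the covector  y \<mapsto> g \<bullet> y.\<close>
definition cometric :: "('a::euclidean_space \<Rightarrow> 'a \<Rightarrow> real) \<Rightarrow> 'a \<Rightarrow> 'a \<Rightarrow> real" where
  "cometric F x g = (SUP y\<in>UNIV - {0}. (g \<bullet> y) / F x y)"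

text \<open>G is a weak gradient of u on Omega (du(x)(y) = G x \<bullet> y).\<close>
definition weak_grad :: "'a::euclidean_space set \<Rightarrow> ('a \<Rightarrow> real) \<Rightarrow> ('a \<Rightarrow> 'a) \<Rightarrow> bool" where
  "weak_grad \<Omega> u G \<longleftrightarrow>
     (\<forall>K. compact K \<and> K \<subseteq> \<Omega> \<longrightarrow> set_integrable lborel K u \<and> set_integrable lborel K G)
   \<and> (\<forall>\<phi>\<in>Cc_inf \<Omega>. \<forall>b\<in>Basis.
        (LINT x:\<Omega>|lborel. u x * frechet_derivative \<phi> (at x) b)
          = - (LINT x:\<Omega>|lborel. \<phi> x * (G x \<bullet> b)))"

definition enn_root :: "real \<Rightarrow> ennreal \<Rightarrow> ennreal" where
  "enn_root p I = (if I = \<infinity> then \<infinity> else ennreal (enn2real I powr (1 / p)))"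

definition sobolev_norm ::
  "'a::euclidean_space set \<Rightarrow> ('a \<Rightarrow> 'a \<Rightarrow> real) \<Rightarrow> 'a measure \<Rightarrow> real \<Rightarrow> ('a \<Rightarrow> real) \<Rightarrow> ennreal" where
  "sobolev_norm \<Omega> F m p u =
     (if \<exists>G. weak_grad \<Omega> u G then
        (let G = (SOME G. weak_grad \<Omega> u G) in
          enn_root p (\<integral>\<^sup>+ x. ennreal (\<bar>u x\<bar> powr p) \<partial>m)
        + enn_root p (\<integral>\<^sup>+ x. ennreal (cometric F x (G x) powr p) \<partial>m))
      else \<infinity>)"

definition W1p0 ::
  "'a::euclidean_space set \<Rightarrow> ('a \<Rightarrow> 'a \<Rightarrow> real) \<Rightarrow> 'a measure \<Rightarrow> real \<Rightarrow> ('a \<Rightarrow> real) set" where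
  "W1p0 \<Omega> F m p = {u. \<exists>\<phi>. (\<forall>k. \<phi> k \<in> Cc_inf \<Omega>)
      \<and> ((\<lambda>k. sobolev_norm \<Omega> F m p (\<lambda>x. u x - \<phi> k x)) \<longlonglongrightarrow> 0)}"

definition sob_dist ::
  "'a::euclidean_space set \<Rightarrow> ('a \<Rightarrow> 'a \<Rightarrow> real) \<Rightarrow> 'a measure \<Rightarrow> real \<Rightarrow> ('a \<Rightarrow> real) \<Rightarrow> ('a \<Rightarrow> real) \<Rightarrow> ennreal" where
  "sob_dist \<Omega> F m p u v = sobolev_norm \<Omega> F m p (\<lambda>x. v x - u x)"

definition forward_open :: "'b set \<Rightarrow> ('b \<Rightarrow> 'b \<Rightarrow> ennreal) \<Rightarrow> 'b set \<Rightarrow> bool" where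
  "forward_open W D S \<longleftrightarrow> S \<subseteq> W \<and>
     (\<forall>u\<in>S. \<exists>R>0. {v\<in>W. D u v < R} \<subseteq> S)"

definition backward_open :: "'b set \<Rightarrow> ('b \<Rightarrow> 'b \<Rightarrow> ennreal) \<Rightarrow> 'b set \<Rightarrow> bool" where
  "backward_open W D S \<longleftrightarrow> S \<subseteq> W \<and>
     (\<forall>u\<in>S. \<exists>R>0. {v\<in>W. D v u < R} \<subseteq> S)"

end

theory Submission
  imports Defs
begin

text \<open>On a Funk space the co-metric at \<open>x\<close> is \<open>g \<mapsto> sup {g \<bullet> (z - x) | z \<in> \<Omega>}\<close>, and the
  Busemann--Hausdorff density is bounded above and below by positive constants. Let \<open>z0\<close> maximise
  a coordinate \<open>b\<close> over the closure of \<open>\<Omega>\<close>. As \<open>x\<close> tends to \<open>z0\<close>, the co-metric of \<open>b\<close> tends to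
  zero, while that of \<open>- b\<close> does not. So a bump near \<open>z0\<close> that rises steeply and falls gently in
  direction \<open>b\<close> can have arbitrarily small energy although its negative has energy at least 1.
  The sum \<open>u\<close> of a sequence of such bumps with disjoint supports shrinking to \<open>z0\<close> is the limit of
  its partial sums \<open>u\<^sub>k\<close>, but \<open>u\<^sub>k - u\<close>, and \<open>- u - \<phi>\<close> for every test function \<open>\<phi>\<close>, have
  infinite energy.\<close>

section \<open>Smooth bump functions\<close>

text \<open>\<open>sobolev_norm\<close> picks its weak gradient by \<open>SOME\<close>, so no energy
  can be evaluated before weak gradients are known to be unique almost everywhere; hence the
  fundamental lemma of the calculus of variations, proved from explicit test functions. A tooth is a
  fixed cutoff times a ramp of width \<epsilon>, scaled by \<open>a\<close>. For the rise of the
  ramp the co-metric is small and that of its reversal is not, but the gradient of the cutoff obeys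
  no such asymmetry. Steepness makes it negligible: as \<open>p > 1\<close>, the energy
  \<open>J\<close> of the ramp grows without bound when \<epsilon> tends to 0 while the cutoff terms
  stay bounded, so the normalisation \<open>a powr p * J = M\<close> makes \<open>a\<close> small
  and leaves only the rise. Disjoint supports make energies additive, which gives a geometric series
  in one direction and a sum of infinitely many terms at least 1 in the other. Since
  \<open>z0\<close> lies outside \<Omega>, a compact subset of \<Omega> meets only finitely many
  supports; so the infinite sum is locally C1, and a test function can alter only finitely many
  teeth.\<close>

definition flat :: "nat \<Rightarrow> real \<Rightarrow> real" where
  "flat n s = (if s > 0 then (1 / s) ^ n * exp (- 1 / s) else 0)"

lemma flat_nonneg: "flat n s \<ge> 0"
  by (simp add: flat_def)

lemma flat_0_le_1: "flat 0 s \<le> 1"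
  by (simp add: flat_def)

lemma flat_0_pos_iff: "flat 0 s \<noteq> 0 \<longleftrightarrow> s > 0"
  by (simp add: flat_def)

text \<open>In the variable \<open>inverse s\<close> the limit from the right is that of a power
  against the exponential; on the left the function vanishes.\<close>

lemma flat_tendsto_0: "(flat n \<longlongrightarrow> 0) (at 0)"
proof (rule filterlim_split_at)
  have "((\<lambda>s::real. (0::real)) \<longlongrightarrow> 0) (at_left 0)" by simp
  then show "(flat n \<longlongrightarrow> 0) (at_left 0)"
    by (rule Lim_transform_eventually)
       (auto simp: eventually_at_filter flat_def intro!: always_eventually)
  have "((\<lambda>s. inverse s ^ n / exp (inverse s)) \<longlongrightarrow> 0) (at_right (0::real))"
    by (rule filterlim_compose[OF tendsto_power_div_exp_0 filterlim_inverse_at_top_right])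
  then show "(flat n \<longlongrightarrow> 0) (at_right 0)"
    by (rule Lim_transform_eventually)
       (auto simp: eventually_at_filter flat_def exp_minus field_simps intro!: always_eventually)
qed

text \<open>Differentiating the exponential factor raises the power by 2, differentiating the power
  raises it by 1. The index \<open>n\<close> exists for this reason: linear combinations of the
  family are closed under differentiation.\<close>

lemma flat_has_derivative:
  "(flat n has_real_derivative (flat (n + 2) s - real n * flat (n + 1) s)) (at s)"
proof -
  consider "s > 0" | "s < 0" | "s = 0" by linarith
  then show ?thesis
  proof cases
    case 1
    have inv: "((\<lambda>s. 1 / s) has_real_derivative - ((1 / s) ^ 2)) (at s)"
      using 1 by (auto intro!: derivative_eq_intros simp: power2_eq_square)
    have pow: "((\<lambda>s. (1 / s) ^ n) has_real_derivative - real n * (1 / s) ^ (n + 1)) (at s)"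
    proof (cases n)
      case (Suc m)
      have alg: "(1 + real m) * (- (a ^ 2) * a ^ m) = - real (Suc m) * a ^ (Suc m + 1)" for a :: real
        by (simp add: power2_eq_square algebra_simps)
      show ?thesis
        unfolding Suc by (rule DERIV_power_Suc[OF inv, of m, THEN DERIV_cong])
          (rule alg)
    qed simp
    have "((\<lambda>s. exp (- 1 / s)) has_real_derivative exp (- 1 / s) * (1 / s) ^ 2) (at s)"
      using DERIV_fun_exp[OF DERIV_minus[OF inv]] by simp
    from DERIV_mult[OF pow this]
    have "((\<lambda>s. (1 / s) ^ n * exp (- 1 / s)) has_real_derivative
            (flat (n + 2) s - real n * flat (n + 1) s)) (at s)"
      using 1 by (simp add: flat_def power2_eq_square algebra_simps)
    then show ?thesis
      by (rule has_field_derivative_transform_within_open[of _ _ _ "{0<..}"])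
         (use 1 in \<open>auto simp: flat_def\<close>)
  next
    case 2
    have "((\<lambda>s. 0) has_real_derivative 0) (at s)" by simp
    then have "(flat n has_real_derivative 0) (at s)"
      by (rule has_field_derivative_transform_within_open[of _ _ _ "{..<0}"])
         (use 2 in \<open>auto simp: flat_def\<close>)
    then show ?thesis using 2 by (simp add: flat_def)
  next
    case 3
    \<comment> \<open>At the junction the difference quotient is itself a member of the family, and
      all members tend to 0 there.\<close>
    have "(\<lambda>h. (flat n (0 + h) - flat n 0) / h) = flat (n + 1)"
      by (auto simp: flat_def fun_eq_iff)
    then have "(flat n has_real_derivative 0) (at 0)"
      using flat_tendsto_0[of "n + 1"] by (simp only: DERIV_def)
    then show ?thesis using 3 by (simp add: flat_def)
  qed
qed

text \<open>The algebra generated by the functions \<open>x \<mapsto> flat n (x \<bullet> a + c)\<close> is closed under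
  directional derivatives, so all its members are smooth.\<close>

inductive flat_alg :: "('a::euclidean_space \<Rightarrow> real) \<Rightarrow> bool" where
  const: "flat_alg (\<lambda>x. c)"
| flat: "flat_alg (\<lambda>x. flat n (x \<bullet> a + c))"
| add: "flat_alg f \<Longrightarrow> flat_alg g \<Longrightarrow> flat_alg (\<lambda>x. f x + g x)"
| mult: "flat_alg f \<Longrightarrow> flat_alg g \<Longrightarrow> flat_alg (\<lambda>x. f x * g x)"

text \<open>Existence of the derivative and membership of its directional values are proved
  together, because the product rule multiplies values of one factor with derivatives of the
  other.\<close>

lemma flat_alg_derivative:
  "flat_alg f \<Longrightarrow> \<exists>f'. (\<forall>x. (f has_derivative f' x) (at x)) \<and> (\<forall>v. flat_alg (\<lambda>x. f' x v))"
proof (induction rule: flat_alg.induct)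
  case (const c)
  show ?case by (rule exI[of _ "\<lambda>x v. 0"]) (auto intro: flat_alg.const)
next
  case (flat n a c)
  let ?f' = "\<lambda>x v. (flat (n + 2) (x \<bullet> a + c) + (- real n) * flat (n + 1) (x \<bullet> a + c)) * (v \<bullet> a)"
  have "((\<lambda>x. flat n (x \<bullet> a + c)) has_derivative ?f' x) (at x)" for x
    by (rule has_derivative_compose[of "\<lambda>x. x \<bullet> a + c" "\<lambda>v. v \<bullet> a",
          OF _ flat_has_derivative[unfolded has_field_derivative_def], THEN has_derivative_eq_rhs])
       (auto intro!: derivative_eq_intros)
  then show ?case
    by (intro exI[of _ ?f'] conjI allI flat_alg.intros)
next
  case (add f g)
  then obtain f' g' where "\<And>x. (f has_derivative f' x) (at x)" "\<And>v. flat_alg (\<lambda>x. f' x v)"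
    "\<And>x. (g has_derivative g' x) (at x)" "\<And>v. flat_alg (\<lambda>x. g' x v)" by metis
  then show ?case
    by (intro exI[of _ "\<lambda>x v. f' x v + g' x v"]) (auto intro!: has_derivative_add flat_alg.add)
next
  case (mult f g)
  then obtain f' g' where "\<And>x. (f has_derivative f' x) (at x)" "\<And>v. flat_alg (\<lambda>x. f' x v)"
    "\<And>x. (g has_derivative g' x) (at x)" "\<And>v. flat_alg (\<lambda>x. g' x v)" by metis
  then show ?case using mult.hyps
    by (intro exI[of _ "\<lambda>x v. f x * g' x v + f' x v * g x"])
       (auto intro!: has_derivative_mult flat_alg.add flat_alg.mult)
qed

lemma flat_alg_differentiable: "flat_alg f \<Longrightarrow> f differentiable (at x)"
  using flat_alg_derivative differentiable_def by blast

lemma flat_alg_frechet: 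
  assumes "flat_alg f" shows "flat_alg (\<lambda>x. frechet_derivative f (at x) v)"
proof -
  obtain f' where f': "\<And>x. (f has_derivative f' x) (at x)" "\<And>v. flat_alg (\<lambda>x. f' x v)"
    using flat_alg_derivative[OF assms] by auto
  then have "frechet_derivative f (at x) = f' x" for x
    using frechet_derivative_at by metis
  then show ?thesis using f'(2) by simp
qed

lemma flat_alg_smooth: "flat_alg f \<Longrightarrow> smooth_on S f"
proof -
  assume f: "flat_alg f"
  have "flat_alg (iter_dderiv f vs)" for vs
    by (induction vs) (use f flat_alg_frechet in auto)
  then show ?thesis by (simp add: smooth_on_def flat_alg_differentiable)
qed

lemma flat_alg_prod: 
  "finite B \<Longrightarrow> (\<And>b. b \<in> B \<Longrightarrow> flat_alg (f b)) \<Longrightarrow> flat_alg (\<lambda>x. \<Prod>b\<in>B. f b x)"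
  by (induction rule: finite_induct) (auto intro: flat_alg.intros)

text \<open>The parameter \<open>k\<close> is a steepness: for every \<open>k > 0\<close> the
  function is nonzero exactly on \<open>box l u\<close>, and for growing \<open>k\<close> it
  approaches the indicator of that box.\<close>

definition bump :: "real \<Rightarrow> 'a \<Rightarrow> 'a \<Rightarrow> 'a::euclidean_space \<Rightarrow> real" where
  "bump k l u x = (\<Prod>b\<in>Basis. flat 0 (k * (x \<bullet> b - l \<bullet> b)) * flat 0 (k * (u \<bullet> b - x \<bullet> b)))"

lemma flat_alg_bump: "flat_alg (bump k l u)"
proof -
  have *: "flat_alg (\<lambda>x. flat 0 (k * (x \<bullet> b - l \<bullet> b)) * flat 0 (k * (u \<bullet> b - x \<bullet> b)))" for b :: 'a
    using flat_alg.mult[OF flat_alg.flat[of 0 "k *\<^sub>R b" "- k * (l \<bullet> b)"]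
                         flat_alg.flat[of 0 "(- k) *\<^sub>R b" "k * (u \<bullet> b)"]]
    by (simp add: algebra_simps)
  show ?thesis
    unfolding bump_def[abs_def] by (rule flat_alg_prod) (auto intro: *)
qed

lemma bump_nonneg: "0 \<le> bump k l u x"
  unfolding bump_def by (intro prod_nonneg mult_nonneg_nonneg ballI flat_nonneg)

lemma bump_le_1: "bump k l u x \<le> 1"
  unfolding bump_def
  by (intro prod_le_1 conjI mult_nonneg_nonneg flat_nonneg mult_le_one flat_0_le_1)

lemma bump_nonzero_iff: "k > 0 \<Longrightarrow> bump k l u x \<noteq> 0 \<longleftrightarrow> x \<in> box l u"
  unfolding bump_def by (auto simp: prod_zero_iff flat_0_pos_iff mem_box zero_less_mult_iff)

text \<open>Inside the box every factor has the form \<open>exp (- 1 / (k * s))\<close> with a fixed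
  \<open>s > 0\<close>, which tends to 1 as \<open>k\<close> grows.\<close>

lemma bump_tendsto: "(\<lambda>i. bump (real (Suc i)) l u x) \<longlonglongrightarrow> indicator (box l u) x"
proof (cases "x \<in> box l u")
  case False
  then have "bump (real (Suc i)) l u x = 0" for i using bump_nonzero_iff[of "real (Suc i)" l u x] by auto
  then show ?thesis using False by simp
next
  case True
  have lim: "(\<lambda>i. flat 0 (real (Suc i) * s)) \<longlonglongrightarrow> 1" if "s > 0" for s
  proof -
    have "(\<lambda>i. exp (- (1 / s) * inverse (real (Suc i)))) \<longlonglongrightarrow> exp (- (1 / s) * 0)"
      by (intro tendsto_intros LIMSEQ_inverse_real_of_nat)
    moreover have "flat 0 (real (Suc i) * s) = exp (- (1 / s) * inverse (real (Suc i)))" for i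
      using that by (simp add: flat_def divide_simps mult_pos_pos del: of_nat_Suc)
    ultimately show ?thesis by simp
  qed
  have "(\<lambda>i. bump (real (Suc i)) l u x) \<longlonglongrightarrow> (\<Prod>b\<in>(Basis::'a set). 1 * 1)"
    unfolding bump_def
    by (intro tendsto_prod tendsto_mult lim) (use True in \<open>auto simp: mem_box\<close>)
  then show ?thesis using True by simp
qed

lemma Cc_infI:
  assumes "smooth_on UNIV \<phi>" "compact K" "K \<subseteq> \<Omega>" "\<And>x. x \<notin> K \<Longrightarrow> \<phi> x = 0"
  shows "\<phi> \<in> Cc_inf \<Omega>"
proof -
  have *: "closure {x. \<phi> x \<noteq> 0} \<subseteq> K"
    using assms by (intro closure_minimal compact_imp_closed) auto
  then have "compact (closure {x. \<phi> x \<noteq> 0})"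
    using assms(2) by (metis closed_closure compact_Int_closed inf.absorb_iff2)
  then show ?thesis using assms * by (auto simp: Cc_inf_def)
qed

lemma bump_in_Cc_inf: "k > 0 \<Longrightarrow> cbox l u \<subseteq> \<Omega> \<Longrightarrow> bump k l u \<in> Cc_inf \<Omega>"
  using bump_nonzero_iff[of k l u] box_subset_cbox[of l u]
  by (intro Cc_infI[of _ "cbox l u"] flat_alg_smooth flat_alg_bump) (simp_all, blast)

section \<open>Weak gradients\<close>

definition C1 :: "('a::euclidean_space \<Rightarrow> real) \<Rightarrow> bool" where
  "C1 f \<longleftrightarrow> (\<forall>x. f differentiable (at x))
     \<and> (\<forall>v. continuous_on UNIV (\<lambda>x. frechet_derivative f (at x) v))"

definition grad :: "('a::euclidean_space \<Rightarrow> real) \<Rightarrow> 'a \<Rightarrow> 'a" where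
  "grad f x = (\<Sum>b\<in>Basis. frechet_derivative f (at x) b *\<^sub>R b)"

lemma grad_inner_Basis: "b \<in> Basis \<Longrightarrow> grad f x \<bullet> b = frechet_derivative f (at x) b"
  by (simp add: grad_def)

lemma C1_has_derivative: "C1 f \<Longrightarrow> (f has_derivative frechet_derivative f (at x)) (at x)"
  by (simp add: C1_def frechet_derivative_works)

lemma C1I:
  assumes "\<And>x. (f has_derivative f' x) (at x)" "\<And>v. continuous_on UNIV (\<lambda>x. f' x v)"
  shows "C1 f"
proof -
  have "frechet_derivative f (at x) = f' x" for x
    using frechet_derivative_at assms(1) by metis
  then show ?thesis using assms unfolding C1_def differentiable_def by auto
qed

lemma C1_continuous: "C1 f \<Longrightarrow> continuous_on S f"
  by (meson C1_def continuous_on_subset differentiable_imp_continuous_on differentiable_on_def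
      differentiable_at_withinI top_greatest)

lemma C1_deriv_continuous: "C1 f \<Longrightarrow> continuous_on S (\<lambda>x. frechet_derivative f (at x) v)"
  unfolding C1_def using continuous_on_subset by blast

lemma grad_continuous: "C1 f \<Longrightarrow> continuous_on S (grad f)"
  unfolding grad_def[abs_def] by (intro continuous_intros C1_deriv_continuous)

lemma C1_add: "C1 f \<Longrightarrow> C1 g \<Longrightarrow> C1 (\<lambda>x. f x + g x)"
  by (rule C1I) (auto intro!: has_derivative_add C1_has_derivative continuous_intros C1_deriv_continuous)

lemma C1_mult: "C1 f \<Longrightarrow> C1 g \<Longrightarrow> C1 (\<lambda>x. f x * g x)"
  by (rule C1I[where f' = "\<lambda>x v. f x * frechet_derivative g (at x) v + frechet_derivative f (at x) v * g x"])
     (intro has_derivative_mult C1_has_derivative continuous_on_add continuous_on_mult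
        C1_deriv_continuous C1_continuous; assumption)+

lemma C1_const: "C1 (\<lambda>x. c)"
  by (rule C1I) (auto intro!: has_derivative_const)

lemma C1_cmult: "C1 f \<Longrightarrow> C1 (\<lambda>x. c * f x)"
  by (intro C1_mult C1_const)

lemma C1_sum: "(\<And>i. i \<in> I \<Longrightarrow> C1 (f i)) \<Longrightarrow> C1 (\<lambda>x. \<Sum>i\<in>I. f i x)"
  by (induction I rule: infinite_finite_induct) (auto intro: C1_add C1_const)

lemma frechet_derivative_plus:
  assumes "f differentiable (at x)" "g differentiable (at x)"
  shows "frechet_derivative (\<lambda>x. f x + g x) (at x) = (\<lambda>v. frechet_derivative f (at x) v + frechet_derivative g (at x) v)"
  by (rule frechet_derivative_at[symmetric], rule has_derivative_add)
     (use assms frechet_derivative_works in auto)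

lemma grad_add: "C1 f \<Longrightarrow> C1 g \<Longrightarrow> grad (\<lambda>x. f x + g x) x = grad f x + grad g x"
  by (simp add: grad_def frechet_derivative_plus C1_def scaleR_left_distrib sum.distrib)

lemma frechet_derivative_times:
  assumes "C1 f" "C1 g"
  shows "frechet_derivative (\<lambda>x. f x * g x) (at x) v = f x * frechet_derivative g (at x) v + frechet_derivative f (at x) v * g x"
  using frechet_derivative_at[OF has_derivative_mult[OF C1_has_derivative[OF assms(1)] C1_has_derivative[OF assms(2)]], symmetric]
  by simp

lemma grad_mult: "C1 f \<Longrightarrow> C1 g \<Longrightarrow> grad (\<lambda>x. f x * g x) x = f x *\<^sub>R grad g x + g x *\<^sub>R grad f x"
  by (simp add: grad_def frechet_derivative_times scaleR_left_distrib sum.distrib scaleR_sum_right mult.commute)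

lemma grad_const: "grad (\<lambda>x. c) x = 0"
  by (simp add: grad_def)

lemma grad_cmult: "C1 f \<Longrightarrow> grad (\<lambda>x. c * f x) x = c *\<^sub>R grad f x"
  by (simp add: grad_mult C1_const grad_const)

lemma grad_sum: "(\<And>i. i \<in> I \<Longrightarrow> C1 (f i)) \<Longrightarrow> grad (\<lambda>x. \<Sum>i\<in>I. f i x) x = (\<Sum>i\<in>I. grad (f i) x)"
  by (induction I rule: infinite_finite_induct) (auto simp: grad_const grad_add C1_sum)

lemma frechet_derivative_zero_outside:
  assumes "closed K" "\<And>x. x \<notin> K \<Longrightarrow> f x = 0" "x \<notin> K"
  shows "frechet_derivative f (at x) v = 0"
proof -
  have "((\<lambda>x. 0) has_derivative (\<lambda>v. 0)) (at x)" by simp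
  then have "(f has_derivative (\<lambda>v. 0)) (at x)"
    by (rule has_derivative_transform_within_open[of _ _ _ _ "- K"]) (use assms in auto)
  then show ?thesis using frechet_derivative_at by metis
qed

lemma grad_zero_outside:
  assumes "closed K" "\<And>x. x \<notin> K \<Longrightarrow> f x = 0" "x \<notin> K"
  shows "grad f x = 0"
  using frechet_derivative_zero_outside[OF assms] by (simp add: grad_def)

lemma smooth_C1: "smooth_on UNIV f \<Longrightarrow> C1 f"
proof -
  assume f: "smooth_on UNIV f"
  have "f differentiable (at x)" for x
    using f[unfolded smooth_on_def, rule_format, of x "[]"] by simp
  moreover have "continuous_on UNIV (\<lambda>x. frechet_derivative f (at x) v)" for v
  proof -
    \<comment> \<open>The directional derivative along \<open>v\<close> is the iterated derivative
      for \<open>[v]\<close>; its own differentiability yields the continuity.\<close>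
    have "iter_dderiv f [v] differentiable (at x)" for x
      using f unfolding smooth_on_def by blast
    then show ?thesis
      by (simp add: differentiable_imp_continuous_on differentiable_on_def)
  qed
  ultimately show ?thesis by (simp add: C1_def)
qed

section \<open>Test functions\<close>

lemma Cc_inf_C1: "\<phi> \<in> Cc_inf \<Omega> \<Longrightarrow> C1 \<phi>"
  by (simp add: Cc_inf_def smooth_C1)

lemma Cc_inf_support:
  assumes "\<phi> \<in> Cc_inf \<Omega>"
  obtains K where "compact K" "K \<subseteq> \<Omega>" "\<And>x. x \<notin> K \<Longrightarrow> \<phi> x = 0"
  using assms closure_subset[of "{x. \<phi> x \<noteq> 0}"] unfolding Cc_inf_def by blast

text \<open>\<open>smooth_on\<close> speaks of all iterated derivatives, so additivity has to hold
  for whole lists of directions before test functions, and with them the partial sums of teeth, can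
  be added.\<close>

lemma iter_dderiv_add:
  assumes "smooth_on UNIV f" "smooth_on UNIV g"
  shows "iter_dderiv (\<lambda>x. f x + g x) vs = (\<lambda>x. iter_dderiv f vs x + iter_dderiv g vs x)"
proof (induction vs)
  case (Cons v vs)
  then show ?case
    using assms by (simp add: smooth_on_def frechet_derivative_plus)
qed simp

lemma Cc_inf_add:
  assumes "f \<in> Cc_inf \<Omega>" "g \<in> Cc_inf \<Omega>"
  shows "(\<lambda>x. f x + g x) \<in> Cc_inf \<Omega>"
proof -
  obtain K L where "compact K" "K \<subseteq> \<Omega>" "\<And>x. x \<notin> K \<Longrightarrow> f x = 0"
    "compact L" "L \<subseteq> \<Omega>" "\<And>x. x \<notin> L \<Longrightarrow> g x = 0"
    using assms by (meson Cc_inf_support)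
  moreover have "smooth_on UNIV (\<lambda>x. f x + g x)"
    using assms iter_dderiv_add[of f g] by (auto simp: smooth_on_def Cc_inf_def)
  ultimately show ?thesis
    by (intro Cc_infI[of _ "K \<union> L"]) auto
qed

lemma Cc_inf_zero: "(\<lambda>x. 0) \<in> Cc_inf \<Omega>"
  using flat_alg_smooth[OF flat_alg.const[of 0]] by (intro Cc_infI[of _ "{}"]) auto

lemma Cc_inf_sum:
  "(\<And>i. i \<in> I \<Longrightarrow> f i \<in> Cc_inf \<Omega>) \<Longrightarrow> (\<lambda>x. \<Sum>i\<in>I. f i x) \<in> Cc_inf \<Omega>"
  by (induction I rule: infinite_finite_induct) (auto intro: Cc_inf_add Cc_inf_zero)

section \<open>Integration by parts\<close>

lemma integrable_continuous_compact_support: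
  fixes f :: "'a::euclidean_space \<Rightarrow> 'b::{banach, second_countable_topology}"
  assumes "compact K" "continuous_on UNIV f" "\<And>x. x \<notin> K \<Longrightarrow> f x = 0"
  shows "integrable lborel f"
proof -
  have "(\<lambda>x. indicator K x *\<^sub>R f x) = f"
    using assms(3) by (auto simp: fun_eq_iff indicator_def)
  then show ?thesis
    using borel_integrable_compact[OF assms(1) continuous_on_subset[OF assms(2) subset_UNIV]] by simp
qed

lemma integral_translate:
  fixes f :: "'a::euclidean_space \<Rightarrow> real"
  assumes "f \<in> borel_measurable borel"
  shows "(LINT x|lborel. f (x + a)) = integral\<^sup>L lborel f"
proof -
  have "integral\<^sup>L (distr lborel borel ((+) a)) f = (LINT x|lborel. f (a + x))"
    by (rule integral_distr) (use assms in auto)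
  then show ?thesis by (simp add: lborel_distr_plus add.commute)
qed

text \<open>The difference quotients have integral zero by translation invariance.\<close>
lemma integral_directional_derivative_zero:
  fixes f :: "'a::euclidean_space \<Rightarrow> real"
  assumes f: "C1 f" and K: "compact K" "\<And>x. x \<notin> K \<Longrightarrow> f x = 0"
  shows "(LINT x|lborel. frechet_derivative f (at x) v) = 0"
proof -
  let ?d = "\<lambda>x. frechet_derivative f (at x) v"
  define t :: "nat \<Rightarrow> real" where "t i = inverse (real (Suc i))" for i
  have t: "0 < t i" "t i \<le> 1" for i
    by (auto simp: t_def field_simps)
  define q where "q i x = (f (x + t i *\<^sub>R v) - f x) / t i" for i x
  have cf: "continuous_on S f" for S using f by (rule C1_continuous)
  have intf: "integrable lborel f"
    by (rule integrable_continuous_compact_support[OF K(1) cf K(2)])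
  have cd: "continuous_on S ?d" for S using f by (rule C1_deriv_continuous)
  obtain M where M: "\<And>x. x \<in> K \<Longrightarrow> \<bar>?d x\<bar> \<le> M" "M \<ge> 0"
  proof -
    have "bounded (?d ` K)" using K(1) cd compact_continuous_image compact_imp_bounded by blast
    then obtain M where "M > 0" "\<forall>y\<in>?d ` K. norm y \<le> M" using bounded_pos by blast
    then show ?thesis by (intro that[of M]) auto
  qed
  have M': "\<bar>?d x\<bar> \<le> M" for x
    using M frechet_derivative_zero_outside[OF compact_imp_closed[OF K(1)], of f x v] K(2)
    by (cases "x \<in> K") auto
  have line: "((\<lambda>s. f (x + s *\<^sub>R v)) has_real_derivative ?d (x + s *\<^sub>R v)) (at s)" for x s
  proof -
    have lin: "linear (frechet_derivative f (at (x + s *\<^sub>R v)))"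
      using f by (simp add: C1_def linear_frechet_derivative)
    have "((\<lambda>s. f (x + s *\<^sub>R v)) has_derivative
            (\<lambda>h::real. frechet_derivative f (at (x + s *\<^sub>R v)) (h *\<^sub>R v))) (at s)"
      by (rule has_derivative_compose[OF _ C1_has_derivative[OF f]])
         (auto intro!: derivative_eq_intros)
    then show ?thesis
      by (simp add: has_field_derivative_def linear_cmul[OF lin] mult.commute[of _ "?d _"]
          mult_commute_abs)
  qed
  \<comment> \<open>By the mean value theorem each quotient is a value of the derivative, so one
    constant serves for all \<open>i\<close> in the dominated convergence.\<close>
  have bound: "\<bar>q i x\<bar> \<le> M" for i x
  proof -
    obtain z where "f (x + t i *\<^sub>R v) - f (x + 0 *\<^sub>R v) = (t i - 0) * ?d (x + z *\<^sub>R v)"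
      using MVT2[OF t(1)[of i], of "\<lambda>s. f (x + s *\<^sub>R v)" "\<lambda>s. ?d (x + s *\<^sub>R v)"] line by blast
    then have "q i x = ?d (x + z *\<^sub>R v)" using t(1)[of i] by (simp add: q_def)
    then show ?thesis using M' by simp
  qed
  have lim: "(\<lambda>i. q i x) \<longlonglongrightarrow> ?d x" for x
  proof -
    have "((\<lambda>h. (f (x + h *\<^sub>R v) - f x) / h) \<longlongrightarrow> ?d x) (at 0)"
      using line[of x 0] by (simp add: DERIV_def)
    moreover have "filterlim t (at 0) sequentially"
      using t LIMSEQ_inverse_real_of_nat unfolding filterlim_at t_def by (auto simp: less_imp_neq)
    ultimately show ?thesis unfolding q_def by (rule filterlim_compose)
  qed
  obtain r where r: "\<And>x. x \<in> K \<Longrightarrow> norm x \<le> r"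
    using compact_imp_bounded[OF K(1)] bounded_iff by blast
  \<comment> \<open>As \<open>t i \<le> 1\<close>, translation moves the support by at most
    \<open>norm v\<close>; one ball contains the supports of all quotients.\<close>
  let ?B = "cball 0 (r + norm v) :: 'a set"
  have supp: "q i x = 0" if "x \<notin> ?B" for i x
  proof -
    have tv: "norm (t i *\<^sub>R v) \<le> norm v"
      using t[of i] mult_right_mono[of "t i" 1 "norm v"] by simp
    have "x \<notin> K" using that r[of x] norm_ge_zero[of v] by (auto simp: dist_norm)
    moreover have "x + t i *\<^sub>R v \<notin> K"
      using that r[of "x + t i *\<^sub>R v"] tv norm_triangle_ineq4[of "x + t i *\<^sub>R v" "t i *\<^sub>R v"]
      by (auto simp: dist_norm)
    ultimately show ?thesis using K(2) by (simp add: q_def)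
  qed
  have mf: "f \<in> borel_measurable borel" "?d \<in> borel_measurable borel"
    using cf cd by (auto intro!: borel_measurable_continuous_onI)
  have mf': "(\<lambda>x. f (x + a)) \<in> borel_measurable borel" for a
    using mf(1) by measurable
  have mq: "q i \<in> borel_measurable lborel" for i
    unfolding q_def[abs_def] using mf(1) mf'[of "t i *\<^sub>R v"] by simp
  have "(\<lambda>i. integral\<^sup>L lborel (q i)) \<longlonglongrightarrow> (LINT x|lborel. ?d x)"
  proof (rule integral_dominated_convergence[where w = "\<lambda>x. M * indicator ?B x"])
    show "integrable lborel (\<lambda>x. M * indicator ?B x)"
      using emeasure_lborel_cball_finite[of 0 "r + norm v"]
      by (intro integrable_mult_right integrable_real_indicator) auto
    show "AE x in lborel. norm (q i x) \<le> M * indicator ?B x" for i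
      using bound supp M(2) by (auto simp: indicator_def)
  qed (use mf mq lim in auto)
  moreover have "integral\<^sup>L lborel (q i) = 0" for i
  proof -
    have "integrable lborel (\<lambda>x. f (x + t i *\<^sub>R v))"
      using integrable_distr[of "(+) (t i *\<^sub>R v)" lborel borel f] intf
      by (simp add: lborel_distr_plus add.commute)
    then show ?thesis
      unfolding q_def using intf integral_translate[OF mf(1), of "t i *\<^sub>R v"] by simp
  qed
  ultimately show ?thesis by (simp add: LIMSEQ_const_iff)
qed

text \<open>The product \<open>f * g\<close> inherits the compact support of \<open>g\<close>, so
  its directional derivative has integral zero, and the product rule splits this integral into the
  two sides.\<close>

lemma integration_by_parts_compact_support:
  fixes f g :: "'a::euclidean_space \<Rightarrow> real"
  assumes fg: "C1 f" "C1 g" and K: "compact K" "\<And>x. x \<notin> K \<Longrightarrow> g x = 0"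
  shows "(LINT x|lborel. f x * frechet_derivative g (at x) v)
       = - (LINT x|lborel. g x * frechet_derivative f (at x) v)"
proof -
  have 1: "integrable lborel (\<lambda>x. f x * frechet_derivative g (at x) v)"
    using frechet_derivative_zero_outside[OF compact_imp_closed[OF K(1)] K(2)]
    by (intro integrable_continuous_compact_support[OF K(1)] continuous_intros C1_continuous
        C1_deriv_continuous fg) auto
  have 2: "integrable lborel (\<lambda>x. g x * frechet_derivative f (at x) v)"
    using K(2)
    by (intro integrable_continuous_compact_support[OF K(1)] continuous_intros C1_continuous
        C1_deriv_continuous fg) auto
  have "(LINT x|lborel. frechet_derivative (\<lambda>x. f x * g x) (at x) v) = 0"
    by (rule integral_directional_derivative_zero[OF C1_mult[OF fg] K(1)]) (use K(2) in auto)
  then show ?thesis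
    using 1 2 by (simp add: frechet_derivative_times[OF fg] mult.commute)
qed

text \<open>A test function sees only a compact part of \<Omega>, so the C1 function may depend on
  that part. Values and gradient are prescribed together, since agreement of values on
  \<open>K\<close> alone does not determine the gradient at points of \<open>K\<close>.\<close>

lemma weak_grad_locally_C1:
  assumes loc: "\<And>K. compact K \<Longrightarrow> K \<subseteq> \<Omega> \<Longrightarrow> \<exists>f. C1 f \<and> (\<forall>x\<in>K. u x = f x \<and> G x = grad f x)"
  shows "weak_grad \<Omega> u G"
  unfolding weak_grad_def
proof (intro conjI allI impI ballI)
  fix K assume K: "compact K \<and> K \<subseteq> \<Omega>"
  then obtain f where f: "C1 f" "\<And>x. x \<in> K \<Longrightarrow> u x = f x \<and> G x = grad f x"
    using loc[of K] by blast
  have Kb: "K \<in> sets lborel" using K by (auto dest: compact_imp_closed)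
  have "set_integrable lborel K f" "set_integrable lborel K (grad f)"
    unfolding set_integrable_def using K f(1)
    by (intro borel_integrable_compact C1_continuous grad_continuous; simp)+
  then show "set_integrable lborel K u" "set_integrable lborel K G"
    using f(2) set_integrable_cong[of lborel lborel K K u f] set_integrable_cong[of lborel lborel K K G "grad f"]
    by auto
next
  fix \<phi> and b :: 'a assume \<phi>: "\<phi> \<in> Cc_inf \<Omega>" and b: "b \<in> Basis"
  obtain K where K: "compact K" "K \<subseteq> \<Omega>" "\<And>x. x \<notin> K \<Longrightarrow> \<phi> x = 0"
    by (rule Cc_inf_support[OF \<phi>]) blast
  obtain f where f: "C1 f" "\<And>x. x \<in> K \<Longrightarrow> u x = f x \<and> G x = grad f x"
    using loc[OF K(1,2)] by blast
  have zero: "frechet_derivative \<phi> (at x) b = 0" if "x \<notin> K" for x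
    using frechet_derivative_zero_outside[OF compact_imp_closed[OF K(1)] K(3) that] .
  have "(\<lambda>x. indicator \<Omega> x *\<^sub>R (u x * frechet_derivative \<phi> (at x) b))
      = (\<lambda>x. f x * frechet_derivative \<phi> (at x) b)"
  proof
    fix x show "indicator \<Omega> x *\<^sub>R (u x * frechet_derivative \<phi> (at x) b) = f x * frechet_derivative \<phi> (at x) b"
      using zero[of x] f(2)[of x] K(2) by (cases "x \<in> K") auto
  qed
  moreover have "(\<lambda>x. indicator \<Omega> x *\<^sub>R (\<phi> x * (G x \<bullet> b))) = (\<lambda>x. \<phi> x * frechet_derivative f (at x) b)"
  proof
    fix x show "indicator \<Omega> x *\<^sub>R (\<phi> x * (G x \<bullet> b)) = \<phi> x * frechet_derivative f (at x) b"
      using K(3)[of x] f(2)[of x] K(2) b by (cases "x \<in> K") (auto simp: grad_inner_Basis)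
  qed
  ultimately show "(LINT x:\<Omega>|lborel. u x * frechet_derivative \<phi> (at x) b)
      = - (LINT x:\<Omega>|lborel. \<phi> x * (G x \<bullet> b))"
    using integration_by_parts_compact_support[OF f(1) Cc_inf_C1[OF \<phi>] K(1,3), where v=b]
    by (simp add: set_lebesgue_integral_def)
qed

text \<open>On \<open>K\<close> the factor \<open>w\<close> is bounded and elsewhere it vanishes, so
  a multiple of \<open>u\<close> restricted to \<open>K\<close> dominates. This supplies the
  integrability under which Bochner integrals of sums and differences split.\<close>

lemma integrable_mult_compact_support:
  fixes u w :: "'a::euclidean_space \<Rightarrow> real"
  assumes "compact K" "K \<subseteq> \<Omega>" "set_integrable lborel K u"
    "continuous_on UNIV w" "\<And>x. x \<notin> K \<Longrightarrow> w x = 0"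
  shows "integrable lborel (\<lambda>x. indicator \<Omega> x *\<^sub>R (u x * w x))"
proof -
  have "bounded (w ` K)"
    using assms(1,4) by (meson compact_continuous_image compact_imp_bounded continuous_on_subset subset_UNIV)
  then obtain M where M: "M > 0" "\<forall>y\<in>w ` K. norm y \<le> M" using bounded_pos by blast
  have eq: "(\<lambda>x. indicator \<Omega> x *\<^sub>R (u x * w x)) = (\<lambda>x. (indicator K x *\<^sub>R u x) * w x)"
    using assms(2,5) by (auto simp: fun_eq_iff indicator_def)
  have [measurable]: "w \<in> borel_measurable borel"
    using assms(4) by (rule borel_measurable_continuous_onI)
  have i: "integrable lborel (\<lambda>x. indicator K x *\<^sub>R u x)"
    using assms(3) by (simp add: set_integrable_def)
  have "integrable lborel (\<lambda>x. (indicator K x *\<^sub>R u x) * w x)"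
  proof (rule Bochner_Integration.integrable_bound)
    show "integrable lborel (\<lambda>x. M * (indicator K x *\<^sub>R u x))" using i by simp
    show "(\<lambda>x. (indicator K x *\<^sub>R u x) * w x) \<in> borel_measurable lborel"
      using borel_measurable_integrable[OF i] by simp
    have "norm (indicator K x *\<^sub>R u x * w x) \<le> norm (M * (indicator K x *\<^sub>R u x))" for x
    proof (cases "x \<in> K")
      case True
      then have "\<bar>u x\<bar> * \<bar>w x\<bar> \<le> \<bar>u x\<bar> * M" using M by (intro mult_left_mono) auto
      then show ?thesis using True M by (simp add: abs_mult mult.commute)
    qed simp
    then show "AE x in lborel. norm (indicator K x *\<^sub>R u x * w x) \<le> norm (M * (indicator K x *\<^sub>R u x))"
      by simp
  qed
  then show ?thesis by (simp only: eq)
qed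

lemma set_integrable_inner_const:
  fixes G :: "'a::euclidean_space \<Rightarrow> 'a"
  assumes "set_integrable lborel K G" shows "set_integrable lborel K (\<lambda>x. G x \<bullet> b)"
  using integrable_inner_left[of b lborel "\<lambda>x. indicator K x *\<^sub>R G x"] assms
  by (simp add: set_integrable_def)

section \<open>Sums of weak gradients and uniqueness almost everywhere\<close>

lemma weak_gradD:
  assumes "weak_grad \<Omega> u G"
  shows "compact K \<Longrightarrow> K \<subseteq> \<Omega> \<Longrightarrow> set_integrable lborel K u"
    and "compact K \<Longrightarrow> K \<subseteq> \<Omega> \<Longrightarrow> set_integrable lborel K G"
    and "\<phi> \<in> Cc_inf \<Omega> \<Longrightarrow> b \<in> Basis \<Longrightarrow>
      (LINT x:\<Omega>|lborel. u x * frechet_derivative \<phi> (at x) b) = - (LINT x:\<Omega>|lborel. \<phi> x * (G x \<bullet> b))"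
  using assms unfolding weak_grad_def by simp_all

lemma weak_grad_add:
  assumes u: "weak_grad \<Omega> u G" and v: "weak_grad \<Omega> v H"
  shows "weak_grad \<Omega> (\<lambda>x. u x + v x) (\<lambda>x. G x + H x)"
  unfolding weak_grad_def
proof (intro conjI allI impI ballI)
  fix K assume "compact K \<and> K \<subseteq> \<Omega>"
  then show "set_integrable lborel K (\<lambda>x. u x + v x)" "set_integrable lborel K (\<lambda>x. G x + H x)"
    using u v unfolding weak_grad_def by (auto intro!: set_integral_add)
next
  fix \<phi> and b :: 'a assume \<phi>: "\<phi> \<in> Cc_inf \<Omega>" and b: "b \<in> Basis"
  obtain K where K: "compact K" "K \<subseteq> \<Omega>" "\<And>x. x \<notin> K \<Longrightarrow> \<phi> x = 0"
    by (rule Cc_inf_support[OF \<phi>]) blast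
  have zero: "frechet_derivative \<phi> (at x) b = 0" if "x \<notin> K" for x
    using frechet_derivative_zero_outside[OF compact_imp_closed[OF K(1)] K(3) that] .
  have c: "C1 \<phi>" using \<phi> by (rule Cc_inf_C1)
  have si: "set_integrable lborel K u" "set_integrable lborel K v"
    "set_integrable lborel K (\<lambda>x. G x \<bullet> b)" "set_integrable lborel K (\<lambda>x. H x \<bullet> b)"
    using u v K unfolding weak_grad_def by (auto intro!: set_integrable_inner_const)
  have i1: "integrable lborel (\<lambda>x. indicator \<Omega> x *\<^sub>R (w x * frechet_derivative \<phi> (at x) b))"
    if "set_integrable lborel K w" for w
    by (rule integrable_mult_compact_support[OF K(1,2) that C1_deriv_continuous[OF c] zero])
  have i2: "integrable lborel (\<lambda>x. indicator \<Omega> x *\<^sub>R (\<phi> x * w x))"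
    if "set_integrable lborel K w" for w
    using integrable_mult_compact_support[OF K(1,2) that C1_continuous[OF c] K(3)]
    by (simp add: mult.commute)
  have "(LINT x:\<Omega>|lborel. (u x + v x) * frechet_derivative \<phi> (at x) b)
      = (LINT x:\<Omega>|lborel. u x * frechet_derivative \<phi> (at x) b)
      + (LINT x:\<Omega>|lborel. v x * frechet_derivative \<phi> (at x) b)"
    unfolding set_lebesgue_integral_def
    using Bochner_Integration.integral_add[OF i1[OF si(1)] i1[OF si(2)]]
    by (simp add: algebra_simps)
  also have "\<dots> = - (LINT x:\<Omega>|lborel. \<phi> x * (G x \<bullet> b)) + - (LINT x:\<Omega>|lborel. \<phi> x * (H x \<bullet> b))"
    using u v \<phi> b unfolding weak_grad_def by simp
  also have "\<dots> = - (LINT x:\<Omega>|lborel. \<phi> x * ((G x + H x) \<bullet> b))"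
    unfolding set_lebesgue_integral_def
    using Bochner_Integration.integral_add[OF i2[OF si(3)] i2[OF si(4)]]
    by (simp add: algebra_simps)
  finally show "(LINT x:\<Omega>|lborel. (u x + v x) * frechet_derivative \<phi> (at x) b)
     = - (LINT x:\<Omega>|lborel. \<phi> x * ((G x + H x) \<bullet> b))" .
qed

text \<open>The positive and negative parts of \<open>g\<close> are the densities of two measures
  that agree on boxes, an intersection-stable generator of the Borel sets, hence on all Borel sets.
  Densities being unique, both parts coincide almost everywhere; as one of them is always 0, so are
  both.\<close>

lemma integrable_eq_0_AE_if_box_integrals_0:
  fixes g :: "'a::euclidean_space \<Rightarrow> real"
  assumes g: "integrable lborel g"
    and box: "\<And>l u. (LINT x|lborel. indicator (box l u) x *\<^sub>R g x) = 0"
  shows "AE x in lborel. g x = 0"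
proof -
  have [measurable]: "g \<in> borel_measurable borel" using g by auto
  let ?M = "density lborel (\<lambda>x. ennreal (g x))" and ?N = "density lborel (\<lambda>x. ennreal (- g x))"
  have fin: "(\<integral>\<^sup>+x. ennreal (indicator A x *\<^sub>R g x) \<partial>lborel) \<noteq> \<infinity>"
            "(\<integral>\<^sup>+x. ennreal (- (indicator A x *\<^sub>R g x)) \<partial>lborel) \<noteq> \<infinity>" if A: "A \<in> sets borel" for A
  proof -
    have "integrable lborel (\<lambda>x. indicator A x *\<^sub>R g x)"
      by (rule integrable_mult_indicator[OF _ g]) (use A in simp)
    then show "(\<integral>\<^sup>+x. ennreal (indicator A x *\<^sub>R g x) \<partial>lborel) \<noteq> \<infinity>"
      "(\<integral>\<^sup>+x. ennreal (- (indicator A x *\<^sub>R g x)) \<partial>lborel) \<noteq> \<infinity>"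
      unfolding real_integrable_def by blast+
  qed
  have em: "emeasure ?M A = (\<integral>\<^sup>+x. ennreal (indicator A x *\<^sub>R g x) \<partial>lborel)"
           "emeasure ?N A = (\<integral>\<^sup>+x. ennreal (- (indicator A x *\<^sub>R g x)) \<partial>lborel)" if "A \<in> sets borel" for A
    using that by (simp_all add: emeasure_density, (intro nn_integral_cong, simp split: split_indicator)+)
  have "?M = ?N"
  proof (rule measure_eqI_generator_eq)
    let ?E = "range (\<lambda>(a, b). box a b::'a set)"
    show "Int_stable ?E" by (auto simp: Int_stable_def box_Int_box)
    show "?E \<subseteq> Pow UNIV" "sets ?M = sigma_sets UNIV ?E" "sets ?N = sigma_sets UNIV ?E"
      by (simp_all add: borel_eq_box)
    let ?A = "\<lambda>n::nat. box (- (real n *\<^sub>R One)) (real n *\<^sub>R One) :: 'a set"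
    show "range ?A \<subseteq> ?E" "(\<Union>i. ?A i) = UNIV"
      unfolding UN_box_eq_UNIV by auto
    show "emeasure ?M (?A i) \<noteq> \<infinity>" for i
      using fin(1)[of "?A i"] em(1)[of "?A i"] by simp
    fix X assume "X \<in> ?E"
    then obtain l u where X: "X = box l u" by auto
    have "integrable lborel (\<lambda>x. indicator X x *\<^sub>R g x)"
      unfolding X by (rule integrable_mult_indicator[OF _ g]) simp
    then have "(LINT x|lborel. indicator X x *\<^sub>R g x) =
      enn2real (\<integral>\<^sup>+x. ennreal (indicator X x *\<^sub>R g x) \<partial>lborel) -
      enn2real (\<integral>\<^sup>+x. ennreal (- (indicator X x *\<^sub>R g x)) \<partial>lborel)"
      by (rule real_lebesgue_integral_def)
    then have "enn2real (emeasure ?M X) = enn2real (emeasure ?N X)"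
      using box[of l u] em[of X] by (simp add: X)
    moreover have "X \<in> sets borel" by (simp add: X)
    then have "emeasure ?M X \<noteq> \<infinity>" "emeasure ?N X \<noteq> \<infinity>"
      by (simp_all only: em fin not_False_eq_True)
    ultimately show "emeasure ?M X = emeasure ?N X"
      by (metis ennreal_enn2real infinity_ennreal_def less_top)
  qed
  then have "AE x in lborel. ennreal (g x) = ennreal (- g x)"
    using sigma_finite_measure.density_unique_iff[OF sigma_finite_lborel, of "\<lambda>x. ennreal (g x)" "\<lambda>x. ennreal (- g x)"] by simp
  then show ?thesis
  proof (rule AE_mp, intro AE_I2 impI)
    fix x assume "ennreal (g x) = ennreal (- g x)"
    then show "g x = 0" by (cases "g x" "0 :: real" rule: linorder_cases) (auto simp: ennreal_neg)
  qed
qed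

text \<open>Bumps of growing steepness turn the hypothesis into vanishing integrals over all boxes
  whose closed box lies in \<Omega>. As \<open>f\<close> is only locally integrable, the criterion
  for integrable functions is applied to its restriction to one box at a time.\<close>

lemma fundamental_lemma_calculus_of_variations:
  fixes f :: "'a::euclidean_space \<Rightarrow> real"
  assumes \<Omega>: "open \<Omega>"
    and int: "\<And>K. compact K \<Longrightarrow> K \<subseteq> \<Omega> \<Longrightarrow> set_integrable lborel K f"
    and zero: "\<And>\<phi>. \<phi> \<in> Cc_inf \<Omega> \<Longrightarrow> (LINT x:\<Omega>|lborel. \<phi> x * f x) = 0"
  shows "AE x in lborel. x \<in> \<Omega> \<longrightarrow> f x = 0"
proof -
  have A: "(LINT x|lborel. indicator (box l u) x *\<^sub>R f x) = 0" if lu: "cbox l u \<subseteq> \<Omega>" for l u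
  proof -
    have i: "integrable lborel (\<lambda>x. indicator (cbox l u) x *\<^sub>R f x)"
      using int[of "cbox l u"] lu by (simp add: set_integrable_def)
    have z: "bump (real (Suc i)) l u x = 0" if "x \<notin> cbox l u" for i x
      using bump_nonzero_iff[of "real (Suc i)" l u x] that box_subset_cbox[of l u] by auto
    have mb: "bump (real (Suc i)) l u \<in> borel_measurable borel" for i
      by (rule borel_measurable_continuous_onI)
         (rule C1_continuous[OF smooth_C1[OF flat_alg_smooth[OF flat_alg_bump]]])
    have eq: "indicator \<Omega> x *\<^sub>R (bump (real (Suc i)) l u x * f x)
            = bump (real (Suc i)) l u x * (indicator (cbox l u) x *\<^sub>R f x)" for i x
      using z[of x i] lu by (auto simp: indicator_def)
    have "(\<lambda>i. LINT x|lborel. bump (real (Suc i)) l u x * (indicator (cbox l u) x *\<^sub>R f x))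
       \<longlonglongrightarrow> (LINT x|lborel. indicator (box l u) x * (indicator (cbox l u) x *\<^sub>R f x))"
    proof (rule integral_dominated_convergence[where w = "\<lambda>x. norm (indicator (cbox l u) x *\<^sub>R f x)"])
      show "AE x in lborel. (\<lambda>i. bump (real (Suc i)) l u x * (indicator (cbox l u) x *\<^sub>R f x))
         \<longlonglongrightarrow> indicator (box l u) x * (indicator (cbox l u) x *\<^sub>R f x)"
        by (intro AE_I2 tendsto_mult bump_tendsto tendsto_const)
      show "AE x in lborel. norm (bump (real (Suc i)) l u x * (indicator (cbox l u) x *\<^sub>R f x))
          \<le> norm (indicator (cbox l u) x *\<^sub>R f x)" for i
        by (intro AE_I2) (simp add: abs_mult mult_left_le_one_le bump_nonneg bump_le_1)
    qed (use i borel_measurable_integrable[OF i] mb in \<open>auto intro!: borel_measurable_times\<close>)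
    moreover have "(LINT x|lborel. bump (real (Suc i)) l u x * (indicator (cbox l u) x *\<^sub>R f x)) = 0" for i
      using zero[OF bump_in_Cc_inf[OF _ lu, of "real (Suc i)"]]
      by (simp only: set_lebesgue_integral_def eq of_nat_0_less_iff zero_less_Suc simp_thms)
    moreover have "(\<lambda>x. indicator (box l u) x * (indicator (cbox l u) x *\<^sub>R f x))
        = (\<lambda>x. indicator (box l u) x *\<^sub>R f x)"
      using box_subset_cbox[of l u] by (auto simp: indicator_def fun_eq_iff)
    ultimately show ?thesis by (simp only: LIMSEQ_const_iff)
  qed
  have B: "AE x in lborel. x \<in> box l u \<longrightarrow> f x = 0" if lu: "cbox l u \<subseteq> \<Omega>" for l u
  proof -
    have "AE x in lborel. indicator (box l u) x *\<^sub>R f x = 0"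
    proof (rule integrable_eq_0_AE_if_box_integrals_0)
      have "set_integrable lborel (box l u) f"
        by (rule set_integrable_subset[OF int[OF compact_cbox lu]]) (auto simp: box_subset_cbox)
      then show "integrable lborel (\<lambda>x. indicator (box l u) x *\<^sub>R f x)"
        by (simp add: set_integrable_def)
      fix l' u' :: 'a
      have "(\<lambda>x. indicator (box l' u') x *\<^sub>R (indicator (box l u) x *\<^sub>R f x))
        = (\<lambda>x. indicator (box l u \<inter> box l' u') x *\<^sub>R f x)" by (auto simp: indicator_def fun_eq_iff)
      moreover have "(LINT x|lborel. indicator (box l u \<inter> box l' u') x *\<^sub>R f x) = 0"
        unfolding box_Int_box by (rule A) (use lu in \<open>simp flip: Int_interval, blast\<close>)
      ultimately show "(LINT x|lborel. indicator (box l' u') x *\<^sub>R (indicator (box l u) x *\<^sub>R f x)) = 0"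
        by (simp only:)
    qed
    then show ?thesis by (rule AE_mp) (auto intro!: AE_I2)
  qed
  let ?F = "{B. \<exists>l u. B = box l u \<and> cbox l u \<subseteq> \<Omega>}"
  \<comment> \<open>Exceptional null sets may be united only countably often, hence the countable
    subcover.\<close>
  obtain F where F: "F \<subseteq> ?F" "countable F" "\<Union>F = \<Union>?F"
    using Lindelof[of ?F] by (auto intro: open_box)
  have cover: "\<Omega> \<subseteq> \<Union>?F"
  proof
    fix x assume "x \<in> \<Omega>"
    then obtain a b where "cbox a b \<subseteq> \<Omega>" "x \<in> box a b" using open_contains_cbox[OF \<Omega>] by metis
    then show "x \<in> \<Union>?F" by blast
  qed
  have "AE x in lborel. \<forall>B\<in>F. x \<in> B \<longrightarrow> f x = 0"
    using F(1) by (intro AE_ball_countable'[OF _ F(2)]) (auto intro: B)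
  then show ?thesis
  proof (rule AE_mp, intro AE_I2 impI)
    fix x assume "\<forall>B\<in>F. x \<in> B \<longrightarrow> f x = 0" "x \<in> \<Omega>"
    moreover from \<open>x \<in> \<Omega>\<close> have "x \<in> \<Union>F" unfolding F(3) by (rule subsetD[OF cover])
    ultimately show "f x = 0" by blast
  qed
qed

text \<open>In each coordinate both gradients represent the same functional on test functions, so
  their difference is annihilated by all of them.\<close>

lemma weak_grad_unique:
  assumes \<Omega>: "open \<Omega>" and G: "weak_grad \<Omega> u G" and H: "weak_grad \<Omega> u H"
  shows "AE x in lborel. x \<in> \<Omega> \<longrightarrow> G x = H x"
proof -
  have "AE x in lborel. x \<in> \<Omega> \<longrightarrow> G x \<bullet> b - H x \<bullet> b = 0" if b: "b \<in> Basis" for b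
  proof (rule fundamental_lemma_calculus_of_variations[OF \<Omega>])
    show "set_integrable lborel K (\<lambda>x. G x \<bullet> b - H x \<bullet> b)" if "compact K" "K \<subseteq> \<Omega>" for K
      by (intro set_integral_diff(1) set_integrable_inner_const weak_gradD(2)[OF G] weak_gradD(2)[OF H] that)
    fix \<phi> assume \<phi>: "\<phi> \<in> Cc_inf \<Omega>"
    obtain K where K: "compact K" "K \<subseteq> \<Omega>" "\<And>x. x \<notin> K \<Longrightarrow> \<phi> x = 0"
      by (rule Cc_inf_support[OF \<phi>]) blast
    have si: "set_integrable lborel K (\<lambda>x. G x \<bullet> b)" "set_integrable lborel K (\<lambda>x. H x \<bullet> b)"
      by (intro set_integrable_inner_const weak_gradD(2)[OF G] weak_gradD(2)[OF H] K)+
    have i2: "integrable lborel (\<lambda>x. indicator \<Omega> x *\<^sub>R (\<phi> x * w x))"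
      if "set_integrable lborel K w" for w
      using integrable_mult_compact_support[OF K(1,2) that C1_continuous[OF Cc_inf_C1[OF \<phi>]] K(3)]
      by (simp add: mult.commute)
    have "(LINT x:\<Omega>|lborel. \<phi> x * (G x \<bullet> b)) = (LINT x:\<Omega>|lborel. \<phi> x * (H x \<bullet> b))"
    proof -
      have "(LINT x:\<Omega>|lborel. u x * frechet_derivative \<phi> (at x) b) = - (LINT x:\<Omega>|lborel. \<phi> x * (G x \<bullet> b))"
        by (rule weak_gradD(3)[OF G \<phi> b])
      moreover have "(LINT x:\<Omega>|lborel. u x * frechet_derivative \<phi> (at x) b) = - (LINT x:\<Omega>|lborel. \<phi> x * (H x \<bullet> b))"
        by (rule weak_gradD(3)[OF H \<phi> b])
      ultimately show ?thesis by (metis neg_equal_iff_equal)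
    qed
    moreover have "(LINT x:\<Omega>|lborel. \<phi> x * (G x \<bullet> b - H x \<bullet> b))
        = (LINT x:\<Omega>|lborel. \<phi> x * (G x \<bullet> b)) - (LINT x:\<Omega>|lborel. \<phi> x * (H x \<bullet> b))"
      unfolding set_lebesgue_integral_def right_diff_distrib scaleR_right_diff_distrib
      by (rule Bochner_Integration.integral_diff[OF i2[OF si(1)] i2[OF si(2)]])
    ultimately show "(LINT x:\<Omega>|lborel. \<phi> x * (G x \<bullet> b - H x \<bullet> b)) = 0" by simp
  qed
  then have "AE x in lborel. \<forall>b\<in>Basis. x \<in> \<Omega> \<longrightarrow> G x \<bullet> b - H x \<bullet> b = 0"
    by (intro AE_finite_allI finite_Basis)
  then show ?thesis
  proof (rule AE_mp, intro AE_I2 impI)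
    fix x assume "\<forall>b\<in>Basis. x \<in> \<Omega> \<longrightarrow> G x \<bullet> b - H x \<bullet> b = 0" "x \<in> \<Omega>"
    then show "G x = H x" by (auto intro: euclidean_eqI[of "G x" "H x"])
  qed
qed

section \<open>Co-metric and measure of a Funk space\<close>

locale funk_space =
  fixes \<Omega> :: "'a::euclidean_space set" and F :: "'a \<Rightarrow> 'a \<Rightarrow> real"
  assumes funk: "funk_metric_space \<Omega> F"
begin

section \<open>The Funk metric and its indicatrices\<close>

lemma domain: "open \<Omega>" "connected \<Omega>" "bounded \<Omega>" "\<Omega> \<noteq> {}"
  using funk by (auto simp: funk_metric_space_def bounded_domain_def)

lemma F_pos: "x \<in> \<Omega> \<Longrightarrow> y \<noteq> 0 \<Longrightarrow> F x y > 0"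
  using funk by (auto simp: funk_metric_space_def finsler_metric_def)

text \<open>Homogeneity with factor 2 at the zero vector reads
  \<open>F x 0 = 2 * F x 0\<close>.\<close>

lemma F_zero: "x \<in> \<Omega> \<Longrightarrow> F x 0 = 0"
proof -
  assume x: "x \<in> \<Omega>"
  have "\<forall>y. \<forall>c::real. c > 0 \<longrightarrow> F x (c *\<^sub>R y) = c * F x y"
    using funk x by (auto simp: funk_metric_space_def finsler_metric_def)
  from this[rule_format, of 2 0] show ?thesis by simp
qed

lemma F_nonneg: "x \<in> \<Omega> \<Longrightarrow> F x y \<ge> 0"
  using F_pos[of x y] F_zero[of x] by (cases "y = 0") auto

lemma F_frontier: "x \<in> \<Omega> \<Longrightarrow> y \<noteq> 0 \<Longrightarrow> x + (1 / F x y) *\<^sub>R y \<in> frontier \<Omega>"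
  using funk by (auto simp: funk_metric_space_def)

lemma frontier_not_in: "z \<in> frontier \<Omega> \<Longrightarrow> z \<notin> \<Omega>"
  using domain(1) by (simp add: frontier_def interior_open)

lemma F_isCont: "x \<in> \<Omega> \<Longrightarrow> y \<noteq> 0 \<Longrightarrow> isCont (\<lambda>(x, y). F x y) (x, y)"
proof -
  assume xy: "x \<in> \<Omega>" "y \<noteq> 0"
  have "smooth_on (\<Omega> \<times> (UNIV - {0})) (\<lambda>(x, y). F x y)"
    using funk by (auto simp: funk_metric_space_def finsler_metric_def)
  then have "iter_dderiv (\<lambda>(x, y). F x y) [] differentiable (at (x, y))"
    unfolding smooth_on_def using xy by blast
  then show ?thesis by (simp add: differentiable_imp_continuous_within)
qed

text \<open>The frontier point reached from \<open>x\<close> in direction \<open>y\<close> lies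
  outside any ball around \<open>x\<close> inside \<Omega>, which bounds
  \<open>norm y / F x y\<close> from below. This gives continuity of \<open>F x\<close> at 0, where
  the smoothness assumption says nothing.\<close>

lemma F_le_norm:
  assumes "x \<in> \<Omega>"
  obtains r where "r > 0" "\<And>y. F x y \<le> norm y / r"
proof -
  obtain r where r: "r > 0" "ball x r \<subseteq> \<Omega>"
    using domain(1) assms openE by blast
  have "F x y \<le> norm y / r" for y
  proof (cases "y = 0")
    case False
    have "x + (1 / F x y) *\<^sub>R y \<notin> ball x r"
      using frontier_not_in[OF F_frontier[OF assms False]] r(2) by blast
    then show ?thesis
      using F_pos[OF assms False] r(1) by (simp add: dist_norm field_simps)
  qed (simp add: F_zero assms)
  then show thesis using that r(1) by blast
qed

text \<open>The indicatrix ball translated to its centre contains the whole domain: by connectedness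
  the function \<open>z \<mapsto> F x (z - x)\<close> would otherwise take the value 1 at a point of \<open>\<Omega>\<close>,
  which then would be a frontier point.\<close>
lemma F_less_1:
  assumes x: "x \<in> \<Omega>" and z: "z \<in> \<Omega>"
  shows "F x (z - x) < 1"
proof (rule ccontr)
  assume ge: "\<not> F x (z - x) < 1"
  let ?q = "\<lambda>z. F x (z - x)"
  obtain r where r: "r > 0" "\<And>y. F x y \<le> norm y / r" using F_le_norm[OF x] by metis
  have "isCont ?q w" if "w \<in> \<Omega>" for w
  proof (cases "w = x")
    case True
    have "((\<lambda>w. norm (w - x) / r) \<longlongrightarrow> norm (x - x) / r) (at x)"
      using r(1) by (intro tendsto_intros) auto
    then have "((\<lambda>w. norm (w - x) / r) \<longlongrightarrow> 0) (at x)" by simp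
    then have "(?q \<longlongrightarrow> 0) (at x)"
      by (rule Lim_null_comparison[rotated])
         (auto intro!: always_eventually simp: r(2) F_nonneg[OF x])
    then show ?thesis using True F_zero[OF x] by (simp add: isCont_def)
  next
    case False
    have "isCont (\<lambda>w. (x, w - x)) w" by (intro continuous_intros)
    from isCont_o2[OF this, of "\<lambda>(x, y). F x y"] F_isCont[OF x, of "w - x"] False
    show ?thesis by simp
  qed
  then have "connected (?q ` \<Omega>)"
    by (intro connected_continuous_image domain(2) continuous_at_imp_continuous_on) auto
  moreover have "0 \<in> ?q ` \<Omega>" using x F_zero[OF x] by (auto intro!: image_eqI[of _ _ x])
  moreover have "?q z \<in> ?q ` \<Omega>" using z by blast
  ultimately have "{0..?q z} \<subseteq> ?q ` \<Omega>" by (rule connected_contains_Icc)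
  then have "1 \<in> ?q ` \<Omega>" using ge by auto
  then obtain w where w: "w \<in> \<Omega>" "F x (w - x) = 1" by auto
  then have "w \<noteq> x" using F_zero[OF x] by auto
  then show False using F_frontier[OF x, of "w - x"] w frontier_not_in by simp
qed

section \<open>The co-metric as a support function\<close>

definition supp_fun :: "'a \<Rightarrow> real" where "supp_fun g = (SUP z\<in>\<Omega>. g \<bullet> z)"

text \<open>On \<open>\<Omega>\<close> this is the co-metric; nothing is known about \<open>cometric F\<close> elsewhere, whereas
  \<open>excess\<close> is continuous everywhere.\<close>
definition excess :: "'a \<Rightarrow> 'a \<Rightarrow> real" where "excess x g = supp_fun g - g \<bullet> x"

definition radius :: real where "radius = (SOME r. r > 0 \<and> (\<forall>z\<in>\<Omega>. norm z \<le> r))"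

lemma radius: "radius > 0" "z \<in> \<Omega> \<Longrightarrow> norm z \<le> radius"
proof -
  have "\<exists>r. r > 0 \<and> (\<forall>z\<in>\<Omega>. norm z \<le> r)" using domain(3) bounded_pos by blast
  from someI_ex[OF this] show "radius > 0" "z \<in> \<Omega> \<Longrightarrow> norm z \<le> radius"
    unfolding radius_def by auto
qed

lemma inner_le_radius: "z \<in> \<Omega> \<Longrightarrow> g \<bullet> z \<le> radius * norm g"
  using radius(2)[of z] norm_cauchy_schwarz[of g z] mult_left_mono[of "norm z" radius "norm g"]
  by (simp add: mult.commute)

lemma bdd_above_inner: "bdd_above ((\<bullet>) g ` \<Omega>)"
  using inner_le_radius by (auto intro!: bdd_aboveI2)

lemma inner_le_supp_fun: "z \<in> \<Omega> \<Longrightarrow> g \<bullet> z \<le> supp_fun g"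
  unfolding supp_fun_def by (rule cSUP_upper[OF _ bdd_above_inner])

lemma supp_fun_least: "(\<And>z. z \<in> \<Omega> \<Longrightarrow> g \<bullet> z \<le> c) \<Longrightarrow> supp_fun g \<le> c"
  unfolding supp_fun_def by (rule cSUP_least[OF domain(4)])

lemma inner_le_supp_fun_closure: "z \<in> closure \<Omega> \<Longrightarrow> g \<bullet> z \<le> supp_fun g"
proof -
  have "closure \<Omega> \<subseteq> {z. g \<bullet> z \<le> supp_fun g}"
    by (intro closure_minimal closed_halfspace_le) (auto intro: inner_le_supp_fun)
  then show "z \<in> closure \<Omega> \<Longrightarrow> g \<bullet> z \<le> supp_fun g" by blast
qed

text \<open>For \<open>\<le>\<close>: \<open>y / F x y\<close> leads from \<open>x\<close> to a
  point of the closure, where the support function bounds \<open>g\<close>. For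
  \<open>\<ge>\<close>: a point \<open>z\<close> of \<Omega> gives the direction
  \<open>z - x\<close> with \<open>F x (z - x) < 1\<close>, and dividing a positive number by this
  can only increase it.\<close>

lemma cometric_eq_excess:
  assumes x: "x \<in> \<Omega>"
  shows "cometric F x g = excess x g"
proof (rule antisym)
  have upper: "g \<bullet> y / F x y \<le> excess x g" if "y \<in> UNIV - {0}" for y
  proof -
    have "x + (1 / F x y) *\<^sub>R y \<in> closure \<Omega>"
      using F_frontier[OF x, of y] that by (simp add: frontier_def)
    then have "g \<bullet> (x + (1 / F x y) *\<^sub>R y) \<le> supp_fun g" by (rule inner_le_supp_fun_closure)
    then show ?thesis by (simp add: excess_def inner_add_right algebra_simps)
  qed
  obtain b :: 'a where "b \<in> Basis" using nonempty_Basis by blast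
  then have b: "b \<noteq> 0" by auto
  then show "cometric F x g \<le> excess x g"
    unfolding cometric_def using upper by (intro cSUP_least) auto
  have bdd: "bdd_above ((\<lambda>y. g \<bullet> y / F x y) ` (UNIV - {0}))"
    using upper by (auto intro!: bdd_aboveI2)
  have lower: "g \<bullet> y / F x y \<le> cometric F x g" if "y \<noteq> 0" for y
    unfolding cometric_def using that by (intro cSUP_upper[OF _ bdd]) auto
  have "g \<bullet> z \<le> cometric F x g + g \<bullet> x" if z: "z \<in> \<Omega>" for z
  proof (cases "g \<bullet> (z - x) \<le> 0")
    case True
    \<comment> \<open>When \<open>g\<close> does not increase from \<open>x\<close> to
      \<open>z\<close>, a nonnegative supremum is enough; one of the two directions \<open>b\<close>
      and \<open>- b\<close> always gives a nonnegative quotient.\<close>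
    have "0 \<le> cometric F x g"
    proof (cases "g \<bullet> b \<ge> 0")
      case True
      then have "0 \<le> g \<bullet> b / F x b" using F_pos[OF x b] by simp
      then show ?thesis using lower[OF b] by linarith
    next
      case False
      then have "0 \<le> g \<bullet> (- b) / F x (- b)" using F_pos[OF x, of "- b"] b by (simp add: divide_nonpos_pos)
      then show ?thesis using lower[of "- b"] b by simp
    qed
    then show ?thesis using True by (simp add: inner_diff_right)
  next
    case False
    then have nz: "z - x \<noteq> 0" by auto
    have "g \<bullet> (z - x) \<le> g \<bullet> (z - x) / F x (z - x)"
      using False F_pos[OF x nz] F_less_1[OF x z] by (simp add: pos_le_divide_eq mult_left_le)
    then show ?thesis using lower[OF nz] by (simp add: inner_diff_right)
  qed
  then show "excess x g \<le> cometric F x g"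
    unfolding excess_def using supp_fun_least[of g "cometric F x g + g \<bullet> x"] by simp
qed

lemma supp_fun_add: "supp_fun (g + h) \<le> supp_fun g + supp_fun h"
  by (rule supp_fun_least) (simp add: inner_add_left add_mono inner_le_supp_fun)

lemma supp_fun_le: "supp_fun g \<le> radius * norm g"
  by (rule supp_fun_least) (rule inner_le_radius)

text \<open>Subadditivity together with the linear bound makes the support function Lipschitz with
  constant \<open>radius\<close>.\<close>

lemma supp_fun_continuous: "continuous_on S supp_fun"
proof -
  have 1: "supp_fun g - supp_fun h \<le> radius * norm (g - h)" for g h
    using supp_fun_add[of h "g - h"] supp_fun_le[of "g - h"] by simp
  have "\<bar>supp_fun g - supp_fun h\<bar> \<le> radius * norm (g - h)" for g h
    using 1[of g h] 1[of h g] by (simp add: norm_minus_commute abs_le_iff)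
  then have "radius-lipschitz_on UNIV supp_fun"
    using radius(1) by (auto simp: lipschitz_on_def dist_norm)
  then show ?thesis
    using lipschitz_on_continuous_on continuous_on_subset by blast
qed

lemma borel_measurable_excess [measurable]:
  "f \<in> borel_measurable M \<Longrightarrow> g \<in> borel_measurable M \<Longrightarrow> (\<lambda>x. excess (f x) (g x)) \<in> borel_measurable M"
  unfolding excess_def
  by (intro borel_measurable_diff borel_measurable_inner
      measurable_compose[OF _ borel_measurable_continuous_onI[OF supp_fun_continuous]])

lemma excess_nonneg: "x \<in> \<Omega> \<Longrightarrow> 0 \<le> excess x g"
  using inner_le_supp_fun[of x g] by (simp add: excess_def)

lemma excess_add: "excess x (g + h) \<le> excess x g + excess x h"
  using supp_fun_add[of g h] by (simp add: excess_def inner_add_left)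

lemma supp_fun_zero: "supp_fun 0 = 0"
  using domain(4) by (simp add: supp_fun_def)

lemma excess_zero: "excess x 0 = 0"
  by (simp add: excess_def supp_fun_zero)

text \<open>One inequality for the support function holds for every positive factor; using it with
  the inverse factor gives the other.\<close>

lemma excess_scaleR: "c \<ge> 0 \<Longrightarrow> excess x (c *\<^sub>R g) = c * excess x g"
proof (cases "c = 0")
  case False
  assume "c \<ge> 0"
  then have c: "c > 0" using False by simp
  have le: "supp_fun (c *\<^sub>R g) \<le> c * supp_fun g" if "c > 0" for c g
    using that by (intro supp_fun_least) (simp add: inner_le_supp_fun)
  have "supp_fun g \<le> inverse c * supp_fun (c *\<^sub>R g)"
    using le[of "inverse c" "c *\<^sub>R g"] c by simp
  then have "supp_fun (c *\<^sub>R g) = c * supp_fun g"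
    using le[OF c, of g] c by (simp add: field_simps)
  then show ?thesis by (simp add: excess_def algebra_simps)
qed (simp add: excess_zero)

lemma excess_le: "x \<in> \<Omega> \<Longrightarrow> excess x g \<le> 2 * radius * norm g"
  using supp_fun_le[of g] inner_le_radius[of x "- g"] by (simp add: excess_def)

text \<open>The point \<open>z0\<close> maximises \<open>z \<mapsto> b \<bullet> z\<close> over the closure of \<open>\<Omega>\<close>.\<close>
lemma exposed_frontier_point:
  assumes b: "b \<noteq> 0" "norm b \<le> 1"
  obtains z0 \<kappa> where "z0 \<in> closure \<Omega>" "z0 \<notin> \<Omega>" "\<kappa> > 0"
    "\<And>x. excess x b \<le> dist x z0"
    "\<And>x. dist x z0 \<le> \<kappa> \<Longrightarrow> \<kappa> \<le> excess x (- b)"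
proof -
  have "compact (closure \<Omega>)" using domain(3) by (simp add: compact_closure)
  moreover have "closure \<Omega> \<noteq> {}" using domain(4) by simp
  moreover have "continuous_on (closure \<Omega>) (\<lambda>z. b \<bullet> z)" by (intro continuous_intros)
  ultimately obtain z0 where z0: "z0 \<in> closure \<Omega>" "\<And>z. z \<in> closure \<Omega> \<Longrightarrow> b \<bullet> z \<le> b \<bullet> z0"
    using continuous_attains_sup[of "closure \<Omega>" "\<lambda>z. b \<bullet> z"] by blast
  \<comment> \<open>A small move along \<open>b\<close> stays in the open set and raises the value,
    so the maximum is not attained in \<Omega>. This also puts \<open>z0\<close> outside
    \<Omega>.\<close>
  have less: "b \<bullet> z < b \<bullet> z0" if z: "z \<in> \<Omega>" for z
  proof -
    obtain r where r: "r > 0" "ball z r \<subseteq> \<Omega>" using domain(1) z openE by blast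
    have "norm ((r/2) *\<^sub>R b) \<le> (r/2) * 1" using b r(1) by (simp add: mult_left_le)
    then have "dist z (z + (r/2) *\<^sub>R b) < r" using r(1) by (simp add: dist_norm)
    then have "z + (r/2) *\<^sub>R b \<in> ball z r" by simp
    then have "z + (r/2) *\<^sub>R b \<in> closure \<Omega>"
      using r(2) closure_subset by blast
    then have "b \<bullet> (z + (r/2) *\<^sub>R b) \<le> b \<bullet> z0" by (rule z0(2))
    moreover have "(r/2) * (b \<bullet> b) > 0" using r b by simp
    ultimately show ?thesis by (simp add: inner_add_right)
  qed
  obtain z1 where z1: "z1 \<in> \<Omega>" using domain(4) by blast
  \<comment> \<open>Half of the drop from \<open>z0\<close> to the interior point \<open>z1\<close>:
    for \<open>dist x z0 \<le> \<kappa>\<close> the point \<open>x\<close> loses at most one half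
    against \<open>z0\<close>, and the other half remains as excess of \<open>- b\<close>.\<close>
  define \<kappa> where "\<kappa> = (b \<bullet> z0 - b \<bullet> z1) / 2"
  have diff: "b \<bullet> (z - w) \<le> dist z w" for z w
    using norm_cauchy_schwarz[of b "z - w"] b(2) mult_right_mono[of "norm b" 1 "norm (z - w)"]
    by (simp add: dist_norm)
  have "supp_fun b \<le> b \<bullet> z0" by (rule supp_fun_least) (use less less_imp_le in blast)
  then have "excess x b \<le> dist x z0" for x
    using diff[of z0 x] by (simp add: excess_def inner_diff_right dist_commute)
  moreover have "\<kappa> \<le> excess x (- b)" if "dist x z0 \<le> \<kappa>" for x
    using inner_le_supp_fun[OF z1, of "- b"] diff[of z0 x] that
    by (simp add: excess_def inner_diff_right dist_commute \<kappa>_def)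
  ultimately show thesis
    using less[OF z1] less z0(1) by (intro that[of z0 \<kappa>]) (auto simp: \<kappa>_def)
qed

section \<open>Measurability and bounds of the Busemann--Hausdorff density\<close>

abbreviation (input) unit_balls :: "('a \<times> 'a) set" where
  "unit_balls \<equiv> {p. fst p \<in> \<Omega> \<and> F (fst p) (snd p) < 1}"

text \<open>Away from the zero vectors \<open>F\<close> is continuous, so that part of the set is
  open; the zero vectors contribute all of \<open>\<Omega> \<times> {0}\<close>. One measurable set
  in the product makes the volume of its sections a measurable function of \<open>x\<close>.\<close>

lemma unit_balls_measurable: "unit_balls \<in> sets (borel \<Otimes>\<^sub>M borel)"
proof -
  let ?U = "\<Omega> \<times> (UNIV - {0}) :: ('a \<times> 'a) set"
  have oU: "open ?U" using domain(1) by (intro open_Times) auto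
  have "continuous_on ?U (\<lambda>(x, y). F x y)"
    by (rule continuous_at_imp_continuous_on) (use F_isCont in auto)
  then have "open (?U \<inter> (\<lambda>(x, y). F x y) -` {..<1})"
    using oU by (intro continuous_open_preimage) auto
  then have "?U \<inter> (\<lambda>(x, y). F x y) -` {..<1} \<in> sets (borel \<Otimes>\<^sub>M borel)"
    by (simp only: borel_prod borel_open)
  moreover have "\<Omega> \<times> {0::'a} \<in> sets (borel \<Otimes>\<^sub>M borel)"
    using domain(1) by (intro pair_measureI) auto
  moreover have "unit_balls = (?U \<inter> (\<lambda>(x, y). F x y) -` {..<1}) \<union> \<Omega> \<times> {0}"
    using F_zero by (auto simp: mem_Times_iff split: prod.splits)
  ultimately show ?thesis by simp
qed

lemma unit_ball_section: "x \<in> \<Omega> \<Longrightarrow> Pair x -` unit_balls = {y. F x y < 1}"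
  by auto

lemma unit_ball_measurable: "x \<in> \<Omega> \<Longrightarrow> {y. F x y < 1} \<in> sets borel"
  using sets_Pair1[OF unit_balls_measurable, of x] by (simp only: unit_ball_section)

text \<open>The translate of \<Omega> by \<open>- x\<close> lies in the unit ball at
  \<open>x\<close> by \<open>F_less_1\<close>. Conversely, \<open>y / F x y\<close> is a difference
  of two points of norm at most \<open>radius\<close>, so the unit ball lies in
  \<open>cball 0 (2 * radius)\<close>.\<close>

lemma unit_ball_bounds:
  assumes x: "x \<in> \<Omega>"
  shows "measure lborel \<Omega> \<le> measure lborel {y. F x y < 1}"
    and "measure lborel {y. F x y < 1} \<le> measure lborel (cball (0::'a) (2 * radius))"
proof -
  let ?B = "{y. F x y < 1}"
  have sub: "?B \<subseteq> cball 0 (2 * radius)"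
  proof
    fix y assume y: "y \<in> ?B"
    show "y \<in> cball 0 (2 * radius)"
    proof (cases "y = 0")
      case False
      have "x + (1 / F x y) *\<^sub>R y \<in> closure \<Omega>"
        using F_frontier[OF x False] by (simp add: frontier_def)
      moreover have "closure \<Omega> \<subseteq> cball 0 radius"
        using radius by (intro closure_minimal) auto
      ultimately have "x + (1 / F x y) *\<^sub>R y \<in> cball 0 radius" by blast
      then have "norm (x + (1 / F x y) *\<^sub>R y) \<le> radius" by simp
      then have "norm ((1 / F x y) *\<^sub>R y) \<le> 2 * radius"
        using norm_triangle_ineq4[of "x + (1 / F x y) *\<^sub>R y" x] radius(2)[OF x] by simp
      then have "norm y \<le> 2 * radius * F x y" using F_pos[OF x False] by (simp add: field_simps)
      also have "\<dots> \<le> 2 * radius" using y radius(1) by (simp add: mult_left_le)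
      finally show ?thesis by simp
    qed (use radius in simp)
  qed
  have em: "?B \<in> sets lborel" using unit_ball_measurable[OF x] by simp
  show "measure lborel ?B \<le> measure lborel (cball (0::'a) (2 * radius))"
    using sub em emeasure_lborel_cball_finite[of "0::'a" "2 * radius"]
    by (intro measure_mono_fmeasurable) (auto simp: fmeasurable_def)
  \<comment> \<open>Translation invariance is used for Lebesgue measure, which agrees with
    \<open>lborel\<close> on the Borel sets concerned.\<close>
  have "measure lborel \<Omega> = measure lebesgue \<Omega>" using domain(1) by simp
  also have "\<dots> = measure lebesgue ((\<lambda>z. z - x) ` \<Omega>)" by (simp add: measure_translation_subtract)
  also have "\<dots> \<le> measure lebesgue ?B"
  proof (rule measure_mono_fmeasurable)
    show "(\<lambda>z. z - x) ` \<Omega> \<subseteq> ?B" using F_less_1[OF x] by auto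
    show "(\<lambda>z. z - x) ` \<Omega> \<in> sets lebesgue"
      using open_translation_subtract[OF domain(1), of x] by simp
    have "?B \<in> lmeasurable"
      using em sub by (intro bounded_set_imp_lmeasurable) (auto intro: bounded_subset[OF bounded_cball])
    then show "?B \<in> fmeasurable lebesgue" .
  qed
  also have "\<dots> = measure lborel ?B" using em by simp
  finally show "measure lborel \<Omega> \<le> measure lborel ?B" .
qed

lemma measure_domain_pos: "measure lborel \<Omega> > 0"
proof -
  obtain x where "x \<in> \<Omega>" using domain(4) by blast
  then obtain r where r: "r > 0" "ball x r \<subseteq> \<Omega>" using domain(1) openE by blast
  have "emeasure lborel \<Omega> < \<infinity>" using domain(3) by (rule emeasure_bounded_finite)
  then have "measure lborel (ball x r) \<le> measure lborel \<Omega>"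
    using r(2) domain(1) by (intro measure_mono_fmeasurable) (auto simp: fmeasurable_def)
  then show ?thesis by (rule less_le_trans[OF content_ball_pos[OF r(1), of x]])
qed

definition m :: "'a measure" where "m = BH_measure \<Omega> F"

definition dens :: "'a \<Rightarrow> ennreal" where
  "dens x = indicator \<Omega> x * ennreal (measure lborel (ball (0::'a) 1) / measure lborel {y. F x y < 1})"

lemma m_eq_density: "m = density lborel dens"
  by (simp add: m_def BH_measure_def dens_def[abs_def])

text \<open>The volume of the unit ball at \<open>x\<close> is that of a section of
  \<open>unit_balls\<close>. The two agree for \<open>x\<close> in \<Omega>; elsewhere the indicator
  makes both expressions 0.\<close>

lemma dens_measurable [measurable]: "dens \<in> borel_measurable borel"
proof -
  have "(\<lambda>x. emeasure lborel (Pair x -` unit_balls)) \<in> borel_measurable borel"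
    by (rule sigma_finite_measure.measurable_emeasure_Pair[OF sigma_finite_lborel])
       (use unit_balls_measurable in \<open>simp cong: sets_pair_measure_cong\<close>)
  then have [measurable]: "(\<lambda>x. measure lborel (Pair x -` unit_balls)) \<in> borel_measurable borel"
    unfolding measure_def by (rule measurable_compose) simp
  have [measurable]: "\<Omega> \<in> sets borel" using domain(1) by simp
  have "(\<lambda>x. indicator \<Omega> x *
      ennreal (measure lborel (ball (0::'a) 1) / measure lborel (Pair x -` unit_balls))) \<in> borel_measurable borel"
    by (intro borel_measurable_times_ennreal borel_measurable_indicator measurable_compose[OF _ measurable_ennreal]
        borel_measurable_divide borel_measurable_const) measurable
  moreover have "(\<lambda>x. indicator \<Omega> x *
      ennreal (measure lborel (ball (0::'a) 1) / measure lborel (Pair x -` unit_balls))) = dens"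
    using unit_ball_section by (auto simp: dens_def fun_eq_iff indicator_def)
  ultimately show ?thesis by (simp only:)
qed

lemma sets_m [simp, measurable_cong]: "sets m = sets borel"
  by (simp add: m_eq_density)

lemma space_m [simp]: "space m = UNIV"
  by (simp add: m_eq_density)

lemma AE_m_domain: "AE x in m. x \<in> \<Omega>"
  unfolding m_eq_density by (subst AE_density) (auto simp: dens_def indicator_def)

lemma AE_m_if_AE_lborel: "AE x in lborel. P x \<Longrightarrow> AE x in m. P x"
  unfolding m_eq_density by (subst AE_density) auto

lemma finite_measure_m: "finite_measure m"
proof
  let ?c = "ennreal (measure lborel (ball (0::'a) 1) / measure lborel \<Omega>)"
  have "dens x \<le> ?c * indicator \<Omega> x" for x
    using unit_ball_bounds(1)[of x] measure_domain_pos
    by (auto simp: dens_def indicator_def intro!: ennreal_leI divide_left_mono mult_pos_pos)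
  then have "(\<integral>\<^sup>+x. dens x \<partial>lborel) \<le> (\<integral>\<^sup>+x. ?c * indicator \<Omega> x \<partial>lborel)"
    by (intro nn_integral_mono) auto
  also have "\<dots> = ?c * emeasure lborel \<Omega>"
    using domain(1) by (intro nn_integral_cmult_indicator) auto
  also have "\<dots> < \<infinity>"
    using emeasure_bounded_finite[OF domain(3)] by (simp add: ennreal_mult_less_top)
  finally show "emeasure m (space m) \<noteq> \<infinity>"
    by (simp add: m_eq_density emeasure_density)
qed

text \<open>The upper bound for the volumes of the unit balls bounds the density from below on
  \<Omega>. It transfers the volume of the slab in \<open>steep_ramp_energy\<close> to
  \<open>m\<close>.\<close>

lemma emeasure_m_lower:
  obtains c where "c > 0" "\<And>A. A \<in> sets borel \<Longrightarrow> A \<subseteq> \<Omega> \<Longrightarrow> ennreal c * emeasure lborel A \<le> emeasure m A"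
proof -
  let ?c = "measure lborel (ball (0::'a) 1) / measure lborel (cball (0::'a) (2 * radius))"
  have pos: "measure lborel (ball (0::'a) 1) > 0" "measure lborel (cball (0::'a) (2 * radius)) > 0"
    using radius(1) content_ball_pos[of 1 "0::'a"] content_cball_pos[of "2 * radius" "0::'a"] by auto
  have "ennreal ?c * emeasure lborel A \<le> emeasure m A" if A: "A \<in> sets borel" "A \<subseteq> \<Omega>" for A
  proof -
    have "ennreal ?c * emeasure lborel A = (\<integral>\<^sup>+x. ennreal ?c * indicator A x \<partial>lborel)"
      using A by (intro nn_integral_cmult_indicator[symmetric]) auto
    also have "\<dots> \<le> (\<integral>\<^sup>+x. dens x * indicator A x \<partial>lborel)"
    proof (rule nn_integral_mono)
      fix x :: 'a
      show "ennreal ?c * indicator A x \<le> dens x * indicator A x"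
      proof (cases "x \<in> A")
        case True
        then have x: "x \<in> \<Omega>" using A by blast
        have "measure lborel {y. F x y < 1} > 0"
          using unit_ball_bounds(1)[OF x] measure_domain_pos by linarith
        then have "ennreal ?c \<le> dens x"
          using unit_ball_bounds(2)[OF x] pos x
          by (auto simp: dens_def intro!: ennreal_leI divide_left_mono mult_pos_pos)
        then show ?thesis using True by simp
      qed simp
    qed
    also have "\<dots> = emeasure m A"
      using A by (simp add: m_eq_density emeasure_density)
    finally show ?thesis .
  qed
  then show thesis using that[of ?c] pos by simp
qed

text \<open>Null sets of \<open>lborel\<close> are null sets of \<open>m\<close>, so uniqueness
  almost everywhere allows any known weak gradient in place of the chosen one; almost every point of
  \<open>m\<close> lies in \<Omega>, where the co-metric is \<open>excess\<close>.\<close>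

lemma sobolev_norm_eq:
  assumes G: "weak_grad \<Omega> u G"
  shows "sobolev_norm \<Omega> F m p u = enn_root p (\<integral>\<^sup>+x. ennreal (\<bar>u x\<bar> powr p) \<partial>m)
    + enn_root p (\<integral>\<^sup>+x. ennreal (excess x (G x) powr p) \<partial>m)"
proof -
  define G' where "G' = (SOME G. weak_grad \<Omega> u G)"
  have ex: "\<exists>G. weak_grad \<Omega> u G" using G by blast
  then have G': "weak_grad \<Omega> u G'" unfolding G'_def by (rule someI_ex)
  have "AE x in m. ennreal (cometric F x (G' x) powr p) = ennreal (excess x (G x) powr p)"
    using AE_m_if_AE_lborel[OF weak_grad_unique[OF domain(1) G' G]] AE_m_domain
    by eventually_elim (simp add: cometric_eq_excess)
  then have "(\<integral>\<^sup>+x. ennreal (cometric F x (G' x) powr p) \<partial>m) = (\<integral>\<^sup>+x. ennreal (excess x (G x) powr p) \<partial>m)"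
    by (rule nn_integral_cong_AE)
  then show ?thesis
    unfolding sobolev_norm_def using ex by (simp add: Let_def G'_def[symmetric])
qed

text \<open>Along an exhaustion of \<Omega> by compact sets the restrictions of \<open>f\<close> are
  measurable and at each point eventually constant. Outside \<Omega> nothing is known about
  \<open>f\<close>, hence the indicator.\<close>

lemma borel_measurable_if_set_integrable_compact:
  fixes f :: "'a \<Rightarrow> 'b::{banach, second_countable_topology}"
  assumes "\<And>K. compact K \<Longrightarrow> K \<subseteq> \<Omega> \<Longrightarrow> set_integrable lborel K f"
  shows "(\<lambda>x. indicator \<Omega> x *\<^sub>R f x) \<in> borel_measurable borel"
proof -
  obtain C where C: "\<And>n. compact (C n)" "\<And>n. C n \<subseteq> \<Omega>"
    "\<And>n. C n \<subseteq> interior (C (Suc n))" "\<Union>(range C) = \<Omega>"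
    using open_Union_compact_subsets[OF domain(1)] by metis
  have mono: "C n \<subseteq> C k" if "n \<le> k" for n k
    using that by (rule lift_Suc_mono_le[of C, rotated]) (use C(3) interior_subset in blast)
  show ?thesis
  proof (rule borel_measurable_LIMSEQ_metric)
    fix n show "(\<lambda>x. indicator (C n) x *\<^sub>R f x) \<in> borel_measurable borel"
      using borel_measurable_integrable[OF assms[OF C(1,2), of n, unfolded set_integrable_def]] by simp
  next
    fix x :: 'a
    show "(\<lambda>n. indicator (C n) x *\<^sub>R f x) \<longlonglongrightarrow> indicator \<Omega> x *\<^sub>R f x"
    proof (cases "x \<in> \<Omega>")
      case True
      then obtain N where "x \<in> C N" using C(4) by blast
      then have "x \<in> C n" if "n \<ge> N" for n using mono[OF that] by blast
      then have "\<forall>\<^sub>F n in sequentially. indicator (C n) x *\<^sub>R f x = indicator \<Omega> x *\<^sub>R f x"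
        using True unfolding eventually_sequentially by (intro exI[of _ N]) auto
      then show ?thesis by (rule tendsto_eventually)
    next
      case False
      then have "x \<notin> C n" for n using C(2) by blast
      then show ?thesis using False by simp
    qed
  qed
qed

end

section \<open>Finiteness of the norm of a sum\<close>

lemma enn_root_less_top_iff: "enn_root p I < \<infinity> \<longleftrightarrow> I < \<infinity>"
  by (auto simp: enn_root_def less_top[symmetric])

text \<open>Both summands are at most their maximum. The crude constant suffices in place of the
  inequality of Minkowski, because only finiteness and orders of magnitude are at stake.\<close>

lemma powr_add_le:
  fixes a b p :: real
  assumes "p > 0" "a \<ge> 0" "b \<ge> 0"
  shows "(a + b) powr p \<le> 2 powr p * (a powr p + b powr p)"
proof -
  have "(a + b) powr p \<le> (2 * max a b) powr p"
    using assms by (intro powr_mono2) auto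
  also have "\<dots> = 2 powr p * max a b powr p" using assms by (simp add: powr_mult)
  also have "\<dots> \<le> 2 powr p * (a powr p + b powr p)"
    by (intro mult_left_mono) (auto simp: max_def)
  finally show ?thesis .
qed

context funk_space
begin

text \<open>This is what remains to be known of the triangle inequality: it makes the functions at
  finite forward distance from a given one a forward open set.\<close>

lemma sobolev_norm_add_finite:
  assumes p: "p > 0" and u: "sobolev_norm \<Omega> F m p u < \<infinity>" and v: "sobolev_norm \<Omega> F m p v < \<infinity>"
  shows "sobolev_norm \<Omega> F m p (\<lambda>x. u x + v x) < \<infinity>"
proof -
  obtain G where G: "weak_grad \<Omega> u G" using u by (auto simp: sobolev_norm_def split: if_splits)
  obtain H where H: "weak_grad \<Omega> v H" using v by (auto simp: sobolev_norm_def split: if_splits)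
  have fin: "(\<integral>\<^sup>+x. ennreal (\<bar>u x\<bar> powr p) \<partial>m) < \<infinity>" "(\<integral>\<^sup>+x. ennreal (\<bar>v x\<bar> powr p) \<partial>m) < \<infinity>"
    "(\<integral>\<^sup>+x. ennreal (excess x (G x) powr p) \<partial>m) < \<infinity>" "(\<integral>\<^sup>+x. ennreal (excess x (H x) powr p) \<partial>m) < \<infinity>"
    using u v enn_root_less_top_iff[of p] unfolding sobolev_norm_eq[OF G] sobolev_norm_eq[OF H]
    by auto
  \<comment> \<open>Used twice, for the absolute values and for the co-metrics of the gradients;
    both are subadditive and nonnegative on \<Omega>.\<close>
  have *: "(\<integral>\<^sup>+x. ennreal (h x powr p) \<partial>m) < \<infinity>"
    if f: "(\<lambda>x. indicator \<Omega> x *\<^sub>R f x) \<in> borel_measurable borel" and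
       g: "(\<lambda>x. indicator \<Omega> x *\<^sub>R g x) \<in> borel_measurable borel"
      and le: "\<And>x. x \<in> \<Omega> \<Longrightarrow> 0 \<le> f x \<and> 0 \<le> g x \<and> 0 \<le> h x \<and> h x \<le> f x + g x"
      and fin: "(\<integral>\<^sup>+x. ennreal (f x powr p) \<partial>m) < \<infinity>" "(\<integral>\<^sup>+x. ennreal (g x powr p) \<partial>m) < \<infinity>"
    for f g h :: "'a \<Rightarrow> real"
  proof -
    let ?f = "\<lambda>x. ennreal ((indicator \<Omega> x *\<^sub>R f x) powr p)"
    let ?g = "\<lambda>x. ennreal ((indicator \<Omega> x *\<^sub>R g x) powr p)"
    have "(\<integral>\<^sup>+x. ennreal (h x powr p) \<partial>m) \<le> (\<integral>\<^sup>+x. ennreal (2 powr p) * (?f x + ?g x) \<partial>m)"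
    proof (rule nn_integral_mono_AE, use AE_m_domain in eventually_elim)
      fix x assume x: "x \<in> \<Omega>"
      have "h x powr p \<le> (f x + g x) powr p" using le[OF x] p by (intro powr_mono2) auto
      also have "\<dots> \<le> 2 powr p * (f x powr p + g x powr p)" using le[OF x] p by (intro powr_add_le) auto
      finally show "ennreal (h x powr p) \<le> ennreal (2 powr p) * (?f x + ?g x)"
        using x by (simp add: ennreal_leI flip: ennreal_mult' ennreal_plus)
    qed
    also have "\<dots> = ennreal (2 powr p) * ((\<integral>\<^sup>+x. ?f x \<partial>m) + (\<integral>\<^sup>+x. ?g x \<partial>m))"
      using f g by (subst nn_integral_cmult, measurable, subst nn_integral_add, measurable)
    also have "(\<integral>\<^sup>+x. ?f x \<partial>m) = (\<integral>\<^sup>+x. ennreal (f x powr p) \<partial>m)"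
      by (rule nn_integral_cong_AE, use AE_m_domain in eventually_elim) simp
    also have "(\<integral>\<^sup>+x. ?g x \<partial>m) = (\<integral>\<^sup>+x. ennreal (g x powr p) \<partial>m)"
      by (rule nn_integral_cong_AE, use AE_m_domain in eventually_elim) simp
    also have "ennreal (2 powr p) * ((\<integral>\<^sup>+x. ennreal (f x powr p) \<partial>m) + (\<integral>\<^sup>+x. ennreal (g x powr p) \<partial>m)) < \<infinity>"
      using fin by (simp add: ennreal_mult_less_top)
    finally show ?thesis .
  qed
  have mu: "(\<lambda>x. indicator \<Omega> x *\<^sub>R u x) \<in> borel_measurable borel"
    "(\<lambda>x. indicator \<Omega> x *\<^sub>R v x) \<in> borel_measurable borel"
    by (intro borel_measurable_if_set_integrable_compact weak_gradD(1)[OF G] weak_gradD(1)[OF H]; assumption)+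
  have mG: "(\<lambda>x. indicator \<Omega> x *\<^sub>R G x) \<in> borel_measurable borel"
    "(\<lambda>x. indicator \<Omega> x *\<^sub>R H x) \<in> borel_measurable borel"
    by (intro borel_measurable_if_set_integrable_compact weak_gradD(2)[OF G] weak_gradD(2)[OF H]; assumption)+
  have abs_eq: "(\<lambda>x. indicator \<Omega> x *\<^sub>R \<bar>w x\<bar>) = (\<lambda>x. \<bar>indicator \<Omega> x *\<^sub>R w x\<bar>)" for w :: "'a \<Rightarrow> real"
    by (auto simp: fun_eq_iff abs_mult)
  \<comment> \<open>The zero covector has excess 0, so the indicator can move inside and
    measurability reduces to that of the cut-off gradient.\<close>
  have ex_eq: "(\<lambda>x. indicator \<Omega> x *\<^sub>R excess x (W x)) = (\<lambda>x. excess x (indicator \<Omega> x *\<^sub>R W x))" for W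
    by (auto simp: fun_eq_iff indicator_def excess_zero)
  have "(\<integral>\<^sup>+x. ennreal (\<bar>u x + v x\<bar> powr p) \<partial>m) < \<infinity>"
    by (rule *[of "\<lambda>x. \<bar>u x\<bar>" "\<lambda>x. \<bar>v x\<bar>"]) (use fin in \<open>auto simp only: abs_eq intro!: borel_measurable_abs mu\<close>)
  moreover have "(\<integral>\<^sup>+x. ennreal (excess x (G x + H x) powr p) \<partial>m) < \<infinity>"
    by (rule *[of "\<lambda>x. excess x (G x)" "\<lambda>x. excess x (H x)"])
       (use fin in \<open>auto simp only: ex_eq intro!: borel_measurable_excess measurable_ident_sets mG excess_nonneg excess_add\<close>)
  ultimately show ?thesis
    unfolding sobolev_norm_eq[OF weak_grad_add[OF G H]] using enn_root_less_top_iff[of p] by auto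
qed

end

section \<open>Steep teeth near an exposed frontier point\<close>

lemma flat_2_le: "flat 2 s \<le> 2"
proof (cases "s > 0")
  case True
  have "(1 / s)\<^sup>2 \<le> 2 * exp (1 / s)"
  proof -
    have "0 < 1 / s" using True by simp
    then show ?thesis using exp_lower_Taylor_quadratic[of "1 / s"] by linarith
  qed
  then show ?thesis using True by (simp add: flat_def exp_minus field_simps)
qed (simp add: flat_def)

text \<open>On the interval from 1 to 2 the power is smallest at 2 and the exponential at 1. As
  \<open>flat 2\<close> is the derivative of \<open>flat 0\<close>, this bounds the slope of the
  ramp from below on a slab.\<close>

lemma flat_2_ge: "1 \<le> s \<Longrightarrow> s \<le> 2 \<Longrightarrow> exp (- 1) / 4 \<le> flat 2 s"
proof -
  assume s: "1 \<le> s" "s \<le> 2"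
  have "(1 / 2) ^ 2 \<le> (1 / s) ^ 2" using s by (intro power_mono) (auto simp: field_simps)
  then have "(1 / 4) * exp (- 1) \<le> (1 / s) ^ 2 * exp (- 1 / s)"
    using s by (intro mult_mono) (auto simp: power2_eq_square)
  then show ?thesis using s by (simp add: flat_def)
qed

text \<open>The argument equals \<open>(x - x0) \<bullet> b / \<epsilon>\<close>; it is written in
  the shape that \<open>flat_alg.flat\<close> produces.\<close>

definition ramp :: "real \<Rightarrow> 'a \<Rightarrow> 'a \<Rightarrow> 'a::euclidean_space \<Rightarrow> real" where
  "ramp \<epsilon> b x0 x = flat 0 (x \<bullet> (b /\<^sub>R \<epsilon>) + (- (x0 \<bullet> b) / \<epsilon>))"

definition slope :: "real \<Rightarrow> 'a \<Rightarrow> 'a \<Rightarrow> 'a::euclidean_space \<Rightarrow> real" where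
  "slope \<epsilon> b x0 x = flat 2 ((x - x0) \<bullet> b / \<epsilon>) / \<epsilon>"

lemma flat_alg_ramp: "flat_alg (ramp \<epsilon> b x0)"
  unfolding ramp_def[abs_def] by (rule flat_alg.flat)

lemma ramp_bounds: "0 \<le> ramp \<epsilon> b x0 x" "ramp \<epsilon> b x0 x \<le> 1"
  by (simp_all add: ramp_def flat_nonneg flat_0_le_1)

lemma grad_ramp:
  assumes "\<epsilon> > 0"
  shows "grad (ramp \<epsilon> b x0) x = slope \<epsilon> b x0 x *\<^sub>R b"
proof -
  let ?t = "x \<bullet> (b /\<^sub>R \<epsilon>) + (- (x0 \<bullet> b) / \<epsilon>)"
  have t: "?t = (x - x0) \<bullet> b / \<epsilon>"
    by (simp add: inner_diff_left diff_divide_distrib divide_inverse algebra_simps)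
  have "(ramp \<epsilon> b x0 has_derivative (\<lambda>v. flat 2 ?t * (v \<bullet> (b /\<^sub>R \<epsilon>)))) (at x)"
    unfolding ramp_def[abs_def]
    by (rule has_derivative_compose[of "\<lambda>x. x \<bullet> (b /\<^sub>R \<epsilon>) + (- (x0 \<bullet> b) / \<epsilon>)" "\<lambda>v. v \<bullet> (b /\<^sub>R \<epsilon>)",
          OF _ flat_has_derivative[of 0, unfolded has_field_derivative_def], THEN has_derivative_eq_rhs])
       (auto intro!: derivative_eq_intros simp: numeral_2_eq_2)
  then have fd: "frechet_derivative (ramp \<epsilon> b x0) (at x) = (\<lambda>v. flat 2 ?t * (v \<bullet> (b /\<^sub>R \<epsilon>)))"
    by (rule frechet_derivative_at[symmetric])
  have "grad (ramp \<epsilon> b x0) x = (\<Sum>i\<in>Basis. (slope \<epsilon> b x0 x * (b \<bullet> i)) *\<^sub>R i)"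
    unfolding grad_def fd t slope_def
    by (intro sum.cong) (auto simp: inner_commute divide_inverse)
  also have "\<dots> = slope \<epsilon> b x0 x *\<^sub>R (\<Sum>i\<in>Basis. (b \<bullet> i) *\<^sub>R i)"
    by (simp add: scaleR_sum_right)
  finally show ?thesis by (simp add: euclidean_representation)
qed

lemma slope_bounds: "\<epsilon> > 0 \<Longrightarrow> 0 \<le> slope \<epsilon> b x0 x" "\<epsilon> > 0 \<Longrightarrow> slope \<epsilon> b x0 x \<le> 2 / \<epsilon>"
  by (simp_all add: slope_def flat_nonneg flat_2_le divide_right_mono)

lemma slope_continuous: "\<epsilon> > 0 \<Longrightarrow> continuous_on S (slope \<epsilon> b x0)"
proof -
  assume "\<epsilon> > 0"
  have "continuous_on UNIV (flat 2)"
    using flat_has_derivative[of 2] DERIV_isCont continuous_at_imp_continuous_on by blast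
  then have "continuous_on S (\<lambda>x. flat 2 ((x - x0) \<bullet> b / \<epsilon>))"
    by (rule continuous_on_compose2) (use \<open>\<epsilon> > 0\<close> in \<open>auto intro!: continuous_intros\<close>)
  then show ?thesis unfolding slope_def[abs_def] using \<open>\<epsilon> > 0\<close> by (auto intro!: continuous_intros)
qed

context funk_space
begin

text \<open>Since \<open>p > 1\<close>, the energy of a step of fixed height and width \<open>\<epsilon>\<close> is at least of order
  \<open>\<epsilon> powr (1 - p)\<close>.\<close>
lemma steep_ramp_energy:
  assumes p: "p > 1" and b: "b \<in> Basis" and \<rho>: "\<rho> > 0"
    and cube: "cbox (x0 - \<rho> *\<^sub>R One) (x0 + \<rho> *\<^sub>R One) \<subseteq> \<Omega>"
    and \<Phi>: "c0 > 0" "\<And>x. x \<in> cbox (x0 - \<rho> *\<^sub>R One) (x0 + \<rho> *\<^sub>R One) \<Longrightarrow> c0 \<le> \<Phi> x"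
  obtains \<epsilon> where "\<epsilon> > 0" "ennreal L \<le> (\<integral>\<^sup>+x. ennreal ((\<Phi> x * slope \<epsilon> b x0 x) powr p) \<partial>m)"
proof -
  define L' where "L' = max L 1"
  obtain c where c: "c > 0" "\<And>A. A \<in> sets borel \<Longrightarrow> A \<subseteq> \<Omega> \<Longrightarrow> ennreal c * emeasure lborel A \<le> emeasure m A"
    using emeasure_m_lower by blast
  \<comment> \<open>The volume of the cross-section of the cube orthogonal to
    \<open>b\<close>.\<close>
  define V where "V = (\<Prod>i\<in>Basis - {b}. 2 * \<rho>)"
  have V: "V > 0" unfolding V_def using \<rho> by (intro prod_pos) auto
  define d where "d = c0 * (exp (- 1) / 4)"
  have d: "d > 0" using \<Phi>(1) by (simp add: d_def)
  define A where "A = d powr p * c * V"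
  have A: "A > 0" using d c V by (simp add: A_def)
  \<comment> \<open>The first bound keeps the slab inside the cube, the second makes
    \<open>A / \<epsilon> powr (p - 1)\<close> at least \<open>L'\<close>.\<close>
  define \<epsilon> where "\<epsilon> = min (\<rho> / 2) ((A / L') powr (1 / (p - 1)))"
  have L': "L' > 0" "L \<le> L'" by (auto simp: L'_def)
  have \<epsilon>: "\<epsilon> > 0" "2 * \<epsilon> \<le> \<rho>" using \<rho> A L' by (auto simp: \<epsilon>_def)
  have "\<epsilon> powr (p - 1) \<le> ((A / L') powr (1 / (p - 1))) powr (p - 1)"
    using p \<epsilon> by (intro powr_mono2) (auto simp: \<epsilon>_def)
  also have "\<dots> = A / L'" using p A L' by (simp add: powr_powr)
  finally have \<epsilon>_le: "L' \<le> A / \<epsilon> powr (p - 1)" using L' \<epsilon> by (simp add: field_simps)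
  \<comment> \<open>The box from \<open>l\<close> to \<open>u\<close> is the slab of the cube on
    which \<open>(x - x0) \<bullet> b / \<epsilon>\<close> runs from 1 to 2.\<close>
  define l where "l = x0 - \<rho> *\<^sub>R One + (\<rho> + \<epsilon>) *\<^sub>R b"
  define u where "u = x0 + \<rho> *\<^sub>R One + (2 * \<epsilon> - \<rho>) *\<^sub>R b"
  have One_i: "One \<bullet> i = (1::real)" if "i \<in> Basis" for i :: 'a
    using that by simp
  have l: "l \<bullet> i = (if i = b then x0 \<bullet> b + \<epsilon> else x0 \<bullet> i - \<rho>)" if "i \<in> Basis" for i
    using that b by (simp add: l_def inner_add_left inner_diff_left One_i inner_not_same_Basis)
  have u: "u \<bullet> i = (if i = b then x0 \<bullet> b + 2 * \<epsilon> else x0 \<bullet> i + \<rho>)" if "i \<in> Basis" for i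
    using that b by (simp add: u_def inner_add_left inner_diff_left One_i inner_not_same_Basis)
  let ?P = "cbox l u"
  have sub: "?P \<subseteq> cbox (x0 - \<rho> *\<^sub>R One) (x0 + \<rho> *\<^sub>R One)"
  proof
    fix x assume x: "x \<in> ?P"
    have "x0 \<bullet> i - \<rho> \<le> x \<bullet> i \<and> x \<bullet> i \<le> x0 \<bullet> i + \<rho>" if i: "i \<in> Basis" for i
      using x l[OF i] u[OF i] i \<epsilon> \<rho> unfolding mem_box by (fastforce split: if_splits)
    then show "x \<in> cbox (x0 - \<rho> *\<^sub>R One) (x0 + \<rho> *\<^sub>R One)"
      by (simp add: mem_box inner_diff_left inner_add_left One_i)
  qed
  have lower: "d / \<epsilon> \<le> \<Phi> x * slope \<epsilon> b x0 x" if x: "x \<in> ?P" for x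
  proof -
    have "x0 \<bullet> b + \<epsilon> \<le> x \<bullet> b" "x \<bullet> b \<le> x0 \<bullet> b + 2 * \<epsilon>"
      using x l[OF b] u[OF b] b unfolding mem_box by (metis (full_types))+
    then have "exp (- 1) / 4 \<le> flat 2 ((x - x0) \<bullet> b / \<epsilon>)"
      using \<epsilon> by (intro flat_2_ge) (auto simp: field_simps inner_diff_left)
    then have "c0 * (exp (- 1) / 4 / \<epsilon>) \<le> \<Phi> x * slope \<epsilon> b x0 x"
      unfolding slope_def using \<Phi>(2)[of x] sub x \<Phi>(1) \<epsilon>
      by (intro mult_mono divide_right_mono) auto
    then show ?thesis by (simp add: d_def)
  qed
  have "measure lborel ?P = (\<Prod>i\<in>Basis. u \<bullet> i - l \<bullet> i)"
    using \<epsilon> \<rho> l u by (intro content_cbox) auto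
  also have "\<dots> = (u \<bullet> b - l \<bullet> b) * (\<Prod>i\<in>Basis - {b}. u \<bullet> i - l \<bullet> i)"
    using b by (simp add: prod.remove)
  also have "(\<Prod>i\<in>Basis - {b}. u \<bullet> i - l \<bullet> i) = V"
    unfolding V_def by (intro prod.cong) (auto simp: l u)
  also have "u \<bullet> b - l \<bullet> b = \<epsilon>" using l[OF b] u[OF b] by simp
  finally have vol: "emeasure lborel ?P = ennreal (\<epsilon> * V)"
    by (metis emeasure_eq_ennreal_measure emeasure_lborel_cbox_finite less_top infinity_ennreal_def)
  have "ennreal L \<le> ennreal ((d / \<epsilon>) powr p * (c * (\<epsilon> * V)))"
  proof (rule ennreal_leI)
    have "(d / \<epsilon>) powr p * (c * (\<epsilon> * V)) = A * (\<epsilon> / \<epsilon> powr p)"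
      using d \<epsilon> by (simp add: A_def powr_divide)
    also have "\<epsilon> / \<epsilon> powr p = 1 / \<epsilon> powr (p - 1)"
      using \<epsilon> by (simp add: powr_diff)
    finally show "L \<le> (d / \<epsilon>) powr p * (c * (\<epsilon> * V))" using \<epsilon>_le L' by simp
  qed
  also have "\<dots> = ennreal ((d / \<epsilon>) powr p) * (ennreal c * emeasure lborel ?P)"
    using c(1) \<epsilon> V by (simp add: vol ennreal_mult)
  also have "\<dots> \<le> ennreal ((d / \<epsilon>) powr p) * emeasure m ?P"
    using sub cube by (intro mult_left_mono c(2)) auto
  also have "\<dots> = (\<integral>\<^sup>+x. ennreal ((d / \<epsilon>) powr p) * indicator ?P x \<partial>m)"
    by (intro nn_integral_cmult_indicator[symmetric]) simp
  also have "\<dots> \<le> (\<integral>\<^sup>+x. ennreal ((\<Phi> x * slope \<epsilon> b x0 x) powr p) \<partial>m)"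
    using lower d \<epsilon> p by (intro nn_integral_mono) (auto simp: indicator_def intro!: ennreal_leI powr_mono2)
  finally show thesis using that \<epsilon>(1) by blast
qed

text \<open>Near \<open>z0\<close> a rise in direction \<open>b\<close> is cheap for the co-metric and a fall is expensive.
  A tooth rises steeply and falls gently, so that its forward energy is small, and the
  energy of its negative large.\<close>
lemma tooth:
  assumes p: "p > 1" and b: "b \<in> Basis" and z0: "z0 \<in> closure \<Omega>" and \<kappa>: "\<kappa> > 0"
    and fwd: "\<And>x. excess x b \<le> dist x z0"
    and bwd: "\<And>x. dist x z0 \<le> \<kappa> \<Longrightarrow> \<kappa> \<le> excess x (- b)"
    and \<eta>: "\<eta> > 0" and \<delta>0: "\<delta>0 > 0"
  shows "\<exists>\<psi>. \<psi> \<in> Cc_inf (\<Omega> \<inter> ball z0 \<delta>0)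
    \<and> (\<integral>\<^sup>+x. ennreal (\<bar>\<psi> x\<bar> powr p) \<partial>m) \<le> ennreal \<eta>
    \<and> (\<integral>\<^sup>+x. ennreal (excess x (grad \<psi> x) powr p) \<partial>m) \<le> ennreal \<eta>
    \<and> 1 \<le> (\<integral>\<^sup>+x. ennreal (excess x (- grad \<psi> x) powr p) \<partial>m)"
proof -
  interpret m: finite_measure m by (rule finite_measure_m)
  define \<mu> where "\<mu> = measure m (space m)"
  have \<mu>: "\<mu> \<ge> 0" by (simp add: \<mu>_def)
  define T where "T = 2 powr p"
  have T: "T > 0" by (simp add: T_def)
  \<comment> \<open>The amplitude will satisfy \<open>a powr p * J = M\<close>. The reversed rise
    then has energy at least \<open>\<kappa> powr p * M = 2 * T\<close>; the factor \<open>T\<close>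
    is lost to \<open>powr_add_le\<close>, and of the remaining 2 the cutoff may consume 1.\<close>
  define M where "M = 2 * T / \<kappa> powr p"
  have M: "M > 0" using \<kappa> T by (simp add: M_def)
  \<comment> \<open>The three bounds keep the tooth in the prescribed ball, keep it where
    \<open>bwd\<close> applies, and hold the forward energy of the rise below
    \<open>\<eta> / 2\<close>.\<close>
  define \<delta> where "\<delta> = min \<delta>0 (min \<kappa> ((\<eta> / (2 * T * M)) powr (1 / p)))"
  have \<delta>: "\<delta> > 0" "\<delta> \<le> \<delta>0" "\<delta> \<le> \<kappa>" using \<delta>0 \<kappa> \<eta> T M by (auto simp: \<delta>_def)
  have "\<delta> powr p \<le> ((\<eta> / (2 * T * M)) powr (1 / p)) powr p"
    using p \<delta> by (intro powr_mono2) (auto simp: \<delta>_def)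
  also have "\<dots> = \<eta> / (2 * T * M)" using p \<eta> T M by (simp add: powr_powr)
  finally have \<delta>M: "T * (\<delta> powr p * M) \<le> \<eta> / 2" using T M by (simp add: field_simps)
  obtain x0 where x0: "x0 \<in> \<Omega>" "dist x0 z0 < \<delta>"
    using z0 \<delta>(1) closure_approachable by blast
  have "open (\<Omega> \<inter> ball z0 \<delta>)" "x0 \<in> \<Omega> \<inter> ball z0 \<delta>"
    using domain(1) x0 by (auto simp: dist_commute)
  then obtain l u where lu: "cbox l u \<subseteq> \<Omega> \<inter> ball z0 \<delta>" "x0 \<in> box l u"
    by (rule open_contains_cbox)
  define \<Phi> where "\<Phi> = bump 1 l u"
  have \<Phi>_alg: "flat_alg \<Phi>" by (simp add: \<Phi>_def flat_alg_bump)
  have \<Phi>_C1: "C1 \<Phi>" by (intro smooth_C1 flat_alg_smooth \<Phi>_alg)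
  have \<Phi>_bounds: "0 \<le> \<Phi> x" "\<Phi> x \<le> 1" for x by (simp_all add: \<Phi>_def bump_nonneg bump_le_1)
  have \<Phi>_zero: "\<Phi> x = 0" if "x \<notin> cbox l u" for x
    using that bump_nonzero_iff[of 1 l u x] box_subset_cbox[of l u] by (auto simp: \<Phi>_def)
  have grad_\<Phi>_zero: "grad \<Phi> x = 0" if "x \<notin> cbox l u" for x
    by (rule grad_zero_outside[OF _ _ that]) (use \<Phi>_zero in auto)
  \<comment> \<open>The cutoff is fixed before the width of the ramp, so this bound does not depend
    on the steepness.\<close>
  obtain C' where C': "\<And>x. norm (grad \<Phi> x) \<le> C'" "C' \<ge> 0"
  proof -
    have "bounded (grad \<Phi> ` cbox l u)"
      by (intro compact_imp_bounded compact_continuous_image grad_continuous \<Phi>_C1 compact_cbox)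
    then obtain B where B: "B > 0" "\<forall>y\<in>grad \<Phi> ` cbox l u. norm y \<le> B" using bounded_pos by blast
    then have "norm (grad \<Phi> x) \<le> B" for x
      using grad_\<Phi>_zero[of x] by (cases "x \<in> cbox l u") auto
    then show thesis using that[of B] B(1) by simp
  qed
  define C where "C = 2 * radius * C'"
  have C: "C \<ge> 0" using radius(1) C'(2) by (simp add: C_def)
  have excess_\<Phi>: "excess x (grad \<Phi> x) \<le> C" if "x \<in> \<Omega>" for x
  proof -
    have "2 * radius * norm (grad \<Phi> x) \<le> 2 * radius * C'"
      using C'(1)[of x] radius(1) by (intro mult_left_mono) auto
    then show ?thesis using excess_le[OF that, of "grad \<Phi> x"] by (simp add: C_def)
  qed
  obtain \<rho> where \<rho>: "\<rho> > 0" "cbox (x0 - \<rho> *\<^sub>R One) (x0 + \<rho> *\<^sub>R One) \<subseteq> box l u"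
  proof -
    define \<rho> where "\<rho> = Min ((\<lambda>i. min (x0 \<bullet> i - l \<bullet> i) (u \<bullet> i - x0 \<bullet> i) / 2) ` Basis)"
    have pos: "\<rho> > 0" unfolding \<rho>_def using lu(2) by (subst Min_gr_iff) (auto simp: mem_box)
    have le: "\<rho> \<le> min (x0 \<bullet> i - l \<bullet> i) (u \<bullet> i - x0 \<bullet> i) / 2" if "i \<in> Basis" for i
      unfolding \<rho>_def using that by (intro Min_le) auto
    have "cbox (x0 - \<rho> *\<^sub>R One) (x0 + \<rho> *\<^sub>R One) \<subseteq> box l u"
    proof
      fix x assume x: "x \<in> cbox (x0 - \<rho> *\<^sub>R One) (x0 + \<rho> *\<^sub>R One)"
      have "l \<bullet> i < x \<bullet> i \<and> x \<bullet> i < u \<bullet> i" if i: "i \<in> Basis" for i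
      proof -
        have "x0 \<bullet> i - \<rho> \<le> x \<bullet> i" "x \<bullet> i \<le> x0 \<bullet> i + \<rho>"
          using x i by (auto simp: mem_box inner_diff_left inner_add_left)
        then show ?thesis using le[OF i] pos by (auto simp: min_def split: if_splits)
      qed
      then show "x \<in> box l u" by (simp add: mem_box)
    qed
    then show thesis using that pos by blast
  qed
  have "continuous_on (cbox (x0 - \<rho> *\<^sub>R One) (x0 + \<rho> *\<^sub>R One)) \<Phi>" by (rule C1_continuous[OF \<Phi>_C1])
  moreover have "x0 \<in> cbox (x0 - \<rho> *\<^sub>R One) (x0 + \<rho> *\<^sub>R One)"
    using \<rho>(1) by (simp add: mem_box inner_diff_left inner_add_left)
  ultimately obtain x1 where x1: "x1 \<in> cbox (x0 - \<rho> *\<^sub>R One) (x0 + \<rho> *\<^sub>R One)"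
    "\<And>x. x \<in> cbox (x0 - \<rho> *\<^sub>R One) (x0 + \<rho> *\<^sub>R One) \<Longrightarrow> \<Phi> x1 \<le> \<Phi> x"
    using continuous_attains_inf[OF compact_cbox] by (metis empty_iff)
  have x1_pos: "\<Phi> x1 > 0"
    using \<Phi>_bounds(1)[of x1] bump_nonzero_iff[of 1 l u x1] x1(1) \<rho>(2) by (auto simp: \<Phi>_def less_le)
  \<comment> \<open>Since \<open>J \<ge> L\<close>, the three summands in the bracket make, in this
    order, the energy of the values at most \<eta>, the cutoff error of the backward energy at most
    1, and that of the forward energy at most \<open>\<eta> / 2\<close>. The leading 1 keeps
    \<open>J\<close> positive.\<close>
  define L where "L = 1 + \<mu> * M * (1 / \<eta> + C powr p + 2 * T * C powr p / \<eta>)"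
  have cube: "cbox (x0 - \<rho> *\<^sub>R One) (x0 + \<rho> *\<^sub>R One) \<subseteq> \<Omega>"
    using \<rho>(2) lu(1) box_subset_cbox[of l u] by blast
  obtain \<epsilon> where \<epsilon>: "\<epsilon> > 0"
    "ennreal L \<le> (\<integral>\<^sup>+x. ennreal ((\<Phi> x * slope \<epsilon> b x0 x) powr p) \<partial>m)"
    by (rule steep_ramp_energy[where \<Phi> = \<Phi>, OF p b \<rho>(1) cube x1_pos x1(2)])
  define s where "s = slope \<epsilon> b x0"
  define \<sigma> where "\<sigma> = ramp \<epsilon> b x0"
  have s: "0 \<le> s x" "s x \<le> 2 / \<epsilon>" for x using slope_bounds[OF \<epsilon>(1)] by (auto simp: s_def)
  have \<sigma>: "0 \<le> \<sigma> x" "\<sigma> x \<le> 1" for x by (simp_all add: \<sigma>_def ramp_bounds)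
  define f where "f x = (\<Phi> x * s x) powr p" for x
  have f_nonneg: "f x \<ge> 0" for x by (simp add: f_def)
  have [measurable]: "\<Phi> \<in> borel_measurable borel" "s \<in> borel_measurable borel"
    using \<epsilon>(1) unfolding s_def
    by (auto intro!: borel_measurable_continuous_onI C1_continuous[OF \<Phi>_C1] slope_continuous)
  have f_meas [measurable]: "f \<in> borel_measurable borel" unfolding f_def[abs_def] by measurable
  have f_le: "f x \<le> (2 / \<epsilon>) powr p" for x
  proof -
    have "\<Phi> x * s x \<le> 1 * (2 / \<epsilon>)" using \<Phi>_bounds[of x] s[of x] by (intro mult_mono) auto
    then show ?thesis unfolding f_def using \<Phi>_bounds[of x] s[of x] p by (intro powr_mono2) auto
  qed
  have f_int: "integrable m f"
    by (rule m.integrable_const_bound[of _ "(2 / \<epsilon>) powr p"]) (use f_le f_nonneg in auto)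
  define J where "J = (LINT x|m. f x)"
  have J_eq: "(\<integral>\<^sup>+x. ennreal (f x) \<partial>m) = ennreal J"
    unfolding J_def using f_int f_nonneg by (intro nn_integral_eq_integral) auto
  have L: "L \<ge> 1" unfolding L_def using \<mu> M \<eta> T by simp
  have J0: "J \<ge> 0" unfolding J_def using f_nonneg by simp
  have "ennreal L \<le> ennreal J" using \<epsilon>(2) J_eq by (simp add: f_def s_def)
  then have JL: "J \<ge> L" using J0 by simp
  then have J: "J > 0" using L by linarith
  \<comment> \<open>This amplitude fixes the \<open>p\<close>-energy of the rise, measured without
    the co-metric, at \<open>M\<close> whatever the width of the ramp.\<close>
  define a where "a = (M / J) powr (1 / p)"
  have a: "a > 0" using M J by (simp add: a_def)
  have ap: "a powr p = M / J" using p M J by (simp add: a_def powr_powr)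
  have small: "\<mu> * (M / J) * (1 / \<eta> + C powr p + 2 * T * C powr p / \<eta>) \<le> 1"
  proof -
    have "\<mu> * M * (1 / \<eta> + C powr p + 2 * T * C powr p / \<eta>) \<le> J" using JL by (simp add: L_def)
    then show ?thesis using J by (simp add: field_simps)
  qed
  have parts: "0 \<le> \<mu> * (M / J) * (1 / \<eta>)" "0 \<le> \<mu> * (M / J) * C powr p"
    "0 \<le> \<mu> * (M / J) * (2 * T * C powr p / \<eta>)"
    using \<mu> M J \<eta> T by auto
  have small1: "\<mu> * (M / J) \<le> \<eta>" and small2: "\<mu> * (M / J) * C powr p \<le> 1"
    and small3: "T * (C powr p * (\<mu> * (M / J))) \<le> \<eta> / 2"
  proof -
    have "\<mu> * (M / J) * (1 / \<eta>) + \<mu> * (M / J) * C powr p + \<mu> * (M / J) * (2 * T * C powr p / \<eta>) \<le> 1"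
      using small by (simp only: distrib_left)
    then have 1: "\<mu> * (M / J) * (1 / \<eta>) \<le> 1" and 2: "\<mu> * (M / J) * C powr p \<le> 1"
      and 3: "\<mu> * (M / J) * (2 * T * C powr p / \<eta>) \<le> 1"
      using parts by linarith+
    show "\<mu> * (M / J) * C powr p \<le> 1" by (rule 2)
    show "\<mu> * (M / J) \<le> \<eta>" using 1 \<eta> J by (simp add: field_simps)
    have "\<mu> * (M / J) * (2 * T * C powr p) \<le> \<eta>" using 3 \<eta> J by (simp add: field_simps)
    then show "T * (C powr p * (\<mu> * (M / J))) \<le> \<eta> / 2" by (simp add: mult_ac)
  qed
  define \<psi> where "\<psi> x = a * (\<Phi> x * \<sigma> x)" for x
  have \<sigma>_C1: "C1 \<sigma>" unfolding \<sigma>_def by (intro smooth_C1 flat_alg_smooth flat_alg_ramp)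
  have "flat_alg \<psi>"
    unfolding \<psi>_def[abs_def] \<sigma>_def by (intro flat_alg.mult flat_alg.const \<Phi>_alg flat_alg_ramp)
  then have \<psi>_Cc: "\<psi> \<in> Cc_inf (\<Omega> \<inter> ball z0 \<delta>0)"
    using lu(1) \<delta>(2) by (intro Cc_infI[of _ "cbox l u"] flat_alg_smooth) (auto simp: \<psi>_def \<Phi>_zero)
  have grad_\<psi>: "grad \<psi> x = (a * (\<Phi> x * s x)) *\<^sub>R b + (a * \<sigma> x) *\<^sub>R grad \<Phi> x" for x
    unfolding \<psi>_def[abs_def]
    using grad_ramp[OF \<epsilon>(1), of b x0 x]
    by (simp add: grad_cmult grad_mult C1_mult \<Phi>_C1 \<sigma>_C1 scaleR_right_distrib flip: \<sigma>_def s_def)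
  have tail: "excess x ((a * \<sigma> x) *\<^sub>R grad \<Phi> x) \<le> a * C" if x: "x \<in> \<Omega>" for x
  proof -
    have "(a * \<sigma> x) * excess x (grad \<Phi> x) \<le> (a * 1) * C"
      using a \<sigma>[of x] excess_\<Phi>[OF x] excess_nonneg[OF x] by (intro mult_mono) auto
    then show ?thesis using a \<sigma>(1)[of x] by (simp add: excess_scaleR)
  qed
  have near: "dist x z0 < \<delta>" if "x \<in> cbox l u" for x
    using lu(1) that by (auto simp: dist_commute)
  have up: "excess x (grad \<psi> x) powr p \<le> T * (\<delta> powr p * (a powr p * f x) + a powr p * C powr p)"
    if x: "x \<in> \<Omega>" for x
  proof -
    have h: "(\<Phi> x * s x) * excess x b \<le> (\<Phi> x * s x) * \<delta>"
    proof (cases "x \<in> cbox l u")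
      case True
      then show ?thesis using fwd[of x] near[OF True] \<Phi>_bounds[of x] s[of x]
        by (intro mult_left_mono) auto
    qed (simp add: \<Phi>_zero)
    have nonneg: "0 \<le> a * (\<Phi> x * s x)" using a \<Phi>_bounds[of x] s[of x] by simp
    have "excess x (grad \<psi> x)
        \<le> excess x ((a * (\<Phi> x * s x)) *\<^sub>R b) + excess x ((a * \<sigma> x) *\<^sub>R grad \<Phi> x)"
      unfolding grad_\<psi> by (rule excess_add)
    also have "\<dots> \<le> (a * (\<Phi> x * s x)) * excess x b + a * C"
      unfolding excess_scaleR[OF nonneg] using tail[OF x] by simp
    also have "\<dots> \<le> \<delta> * (a * (\<Phi> x * s x)) + a * C"
      using mult_left_mono[OF h, of a] a by (simp add: mult_ac)
    finally have "excess x (grad \<psi> x) powr p \<le> (\<delta> * (a * (\<Phi> x * s x)) + a * C) powr p"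
      using excess_nonneg[OF x] p by (intro powr_mono2) auto
    also have "\<dots> \<le> T * ((\<delta> * (a * (\<Phi> x * s x))) powr p + (a * C) powr p)"
      unfolding T_def using p \<delta> a C \<Phi>_bounds[of x] s[of x] by (intro powr_add_le) auto
    also have "\<dots> = T * (\<delta> powr p * (a powr p * f x) + a powr p * C powr p)"
      using \<delta> a C \<Phi>_bounds[of x] s[of x] by (simp add: powr_mult f_def)
    finally show ?thesis .
  qed
  \<comment> \<open>Only subadditivity of \<open>excess\<close> is available, so the reversed rise
    is written as \<open>- grad \<psi> x\<close> plus the cutoff term, which then moves to the error
    side.\<close>
  have down: "\<kappa> powr p * (a powr p * f x) \<le> T * (excess x (- grad \<psi> x) powr p + a powr p * C powr p)"
    if x: "x \<in> \<Omega>" for x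
  proof -
    have "(\<Phi> x * s x) * \<kappa> \<le> (\<Phi> x * s x) * excess x (- b)"
    proof (cases "x \<in> cbox l u")
      case True
      then show ?thesis using bwd[of x] near[OF True] \<delta>(3) \<Phi>_bounds[of x] s[of x]
        by (intro mult_left_mono) auto
    qed (simp add: \<Phi>_zero)
    then have "\<kappa> * (a * (\<Phi> x * s x)) \<le> (a * (\<Phi> x * s x)) * excess x (- b)"
      using a by (simp add: mult_ac)
    also have "\<dots> = excess x ((a * (\<Phi> x * s x)) *\<^sub>R (- b))"
      using a \<Phi>_bounds[of x] s[of x] by (intro excess_scaleR[symmetric]) auto
    also have "(a * (\<Phi> x * s x)) *\<^sub>R (- b) = - grad \<psi> x + (a * \<sigma> x) *\<^sub>R grad \<Phi> x"
      by (simp add: grad_\<psi>)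
    also have "excess x \<dots> \<le> excess x (- grad \<psi> x) + a * C"
      using excess_add[of x "- grad \<psi> x" "(a * \<sigma> x) *\<^sub>R grad \<Phi> x"] tail[OF x] by linarith
    finally have "(\<kappa> * (a * (\<Phi> x * s x))) powr p \<le> (excess x (- grad \<psi> x) + a * C) powr p"
      using \<kappa> a p \<Phi>_bounds[of x] s[of x] by (intro powr_mono2) auto
    also have "\<dots> \<le> T * (excess x (- grad \<psi> x) powr p + (a * C) powr p)"
      unfolding T_def using p a C excess_nonneg[OF x] by (intro powr_add_le) auto
    finally show ?thesis
      using \<kappa> a C \<Phi>_bounds[of x] s[of x] by (simp add: powr_mult f_def)
  qed
  have "(\<integral>\<^sup>+x. ennreal (\<bar>\<psi> x\<bar> powr p) \<partial>m) \<le> (\<integral>\<^sup>+x. ennreal (a powr p) \<partial>m)"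
  proof (intro nn_integral_mono ennreal_leI powr_mono2)
    fix x show "\<bar>\<psi> x\<bar> \<le> a"
      using a \<Phi>_bounds[of x] \<sigma>[of x] mult_le_one[of "\<Phi> x" "\<sigma> x"]
      by (simp add: \<psi>_def abs_mult mult_left_le)
  qed (use p in auto)
  also have "\<dots> = ennreal (\<mu> * (M / J))"
    using M J by (simp add: ap m.emeasure_eq_measure \<mu>_def mult.commute flip: ennreal_mult'')
  also have "\<dots> \<le> ennreal \<eta>" using small1 by (rule ennreal_leI)
  finally have E1: "(\<integral>\<^sup>+x. ennreal (\<bar>\<psi> x\<bar> powr p) \<partial>m) \<le> ennreal \<eta>" .
  have grad_meas [measurable]: "grad \<psi> \<in> borel_measurable borel"
    using \<psi>_Cc by (intro borel_measurable_continuous_onI grad_continuous Cc_inf_C1)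
  have "(\<integral>\<^sup>+x. ennreal (excess x (grad \<psi> x) powr p) \<partial>m)
      \<le> (\<integral>\<^sup>+x. ennreal (T * (\<delta> powr p * (a powr p * f x) + a powr p * C powr p)) \<partial>m)"
    by (rule nn_integral_mono_AE, use AE_m_domain in eventually_elim) (intro ennreal_leI up)
  also have "\<dots> = ennreal (LINT x|m. T * (\<delta> powr p * (a powr p * f x) + a powr p * C powr p))"
    using f_int f_nonneg T by (intro nn_integral_eq_integral) auto
  also have "(LINT x|m. T * (\<delta> powr p * (a powr p * f x) + a powr p * C powr p))
      = T * (\<delta> powr p * (a powr p * J) + \<mu> * (a powr p * C powr p))"
    using f_int by (simp add: J_def \<mu>_def)
  also have "\<dots> = T * (\<delta> powr p * M) + T * (C powr p * (\<mu> * (M / J)))"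
    using J by (simp add: ap algebra_simps)
  also have "ennreal \<dots> \<le> ennreal \<eta>" using \<delta>M small3 by (intro ennreal_leI) linarith
  finally have E2: "(\<integral>\<^sup>+x. ennreal (excess x (grad \<psi> x) powr p) \<partial>m) \<le> ennreal \<eta>" .
  have "1 \<le> (\<integral>\<^sup>+x. ennreal (excess x (- grad \<psi> x) powr p) \<partial>m)" (is "1 \<le> ?I")
  proof (cases "?I = \<infinity>")
    case False
    then obtain I where I: "?I = ennreal I" "I \<ge> 0" by (metis ennreal_cases infinity_ennreal_def)
    have int: "integrable m (\<lambda>x. excess x (- grad \<psi> x) powr p)"
      by (rule integrableI_nonneg) (use False in \<open>auto simp: less_top[symmetric]\<close>)
    have I_eq: "(LINT x|m. excess x (- grad \<psi> x) powr p) = I"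
      using I by (intro integral_eq_nn_integral[THEN trans]) auto
    have "(LINT x|m. \<kappa> powr p * (a powr p * f x)) \<le> (LINT x|m. T * (excess x (- grad \<psi> x) powr p + a powr p * C powr p))"
      by (rule integral_mono_AE) (use f_int int AE_m_domain down in \<open>auto elim!: eventually_mono\<close>)
    then have "\<kappa> powr p * (a powr p * J) \<le> T * (I + \<mu> * (a powr p * C powr p))"
      using f_int int by (simp add: J_def \<mu>_def I_eq mult.assoc)
    also have "\<kappa> powr p * (a powr p * J) = T * 2"
      using J \<kappa> by (simp add: ap M_def)
    finally have "2 \<le> I + \<mu> * (M / J) * C powr p" using T by (simp add: ap mult.assoc)
    then have "1 \<le> I" using small2 by linarith
    then show ?thesis using I by simp
  qed simp
  with E1 E2 \<psi>_Cc show ?thesis by blast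
qed

end

section \<open>Superposition of teeth\<close>

locale teeth = funk_space +
  fixes p :: real and \<psi> :: "nat \<Rightarrow> 'a \<Rightarrow> real" and K :: "nat \<Rightarrow> 'a set"
  assumes p: "p > 1"
    and \<psi>: "\<psi> n \<in> Cc_inf \<Omega>"
    and K: "compact (K n)" "x \<notin> K n \<Longrightarrow> \<psi> n x = 0"
    and disjoint: "i \<noteq> j \<Longrightarrow> K i \<inter> K j = {}"
    and locally_finite: "compact L \<Longrightarrow> L \<subseteq> \<Omega> \<Longrightarrow> \<exists>N. \<forall>n\<ge>N. K n \<inter> L = {}"
    and energy_0: "(\<integral>\<^sup>+x. ennreal (\<bar>\<psi> n x\<bar> powr p) \<partial>m) \<le> ennreal ((1 / 2) ^ n)"
    and energy_forward: "(\<integral>\<^sup>+x. ennreal (excess x (grad (\<psi> n) x) powr p) \<partial>m) \<le> ennreal ((1 / 2) ^ n)"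
    and energy_backward: "1 \<le> (\<integral>\<^sup>+x. ennreal (excess x (- grad (\<psi> n) x) powr p) \<partial>m)"

text \<open>Dependent choice of a tooth, a compact set carrying it and a radius. That set lies in
  \<Omega> and hence misses \<open>z0\<close>, so the next radius can be taken so small that the new
  ball avoids it; as the radii decrease, all later teeth avoid it too.\<close>

lemma (in funk_space) teeth_exist:
  assumes p: "p > 1"
  shows "\<exists>\<psi> K. teeth \<Omega> F p \<psi> K"
proof -
  obtain b :: 'a where b: "b \<in> Basis" using nonempty_Basis by blast
  obtain z0 \<kappa> where z0: "z0 \<in> closure \<Omega>" "z0 \<notin> \<Omega>" and \<kappa>: "\<kappa> > 0"
    and fwd: "\<And>x. excess x b \<le> dist x z0"
    and bwd: "\<And>x. dist x z0 \<le> \<kappa> \<Longrightarrow> \<kappa> \<le> excess x (- b)"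
    using exposed_frontier_point[of b] b by (metis nonzero_Basis norm_Basis order_refl)
  define P where "P n t = (case t of (\<psi>, K, \<delta>) \<Rightarrow> \<psi> \<in> Cc_inf \<Omega> \<and> compact K \<and> K \<subseteq> \<Omega> \<inter> ball z0 \<delta>
      \<and> (\<forall>x. x \<notin> K \<longrightarrow> \<psi> x = 0) \<and> \<delta> \<le> 1 / real (Suc n) \<and> \<delta> > 0
      \<and> (\<integral>\<^sup>+x. ennreal (\<bar>\<psi> x\<bar> powr p) \<partial>m) \<le> ennreal ((1 / 2) ^ n)
      \<and> (\<integral>\<^sup>+x. ennreal (excess x (grad \<psi> x) powr p) \<partial>m) \<le> ennreal ((1 / 2) ^ n)
      \<and> 1 \<le> (\<integral>\<^sup>+x. ennreal (excess x (- grad \<psi> x) powr p) \<partial>m))"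
    for n and t :: "('a \<Rightarrow> real) \<times> 'a set \<times> real"
  define Q where "Q s t = (case s of (\<psi> :: 'a \<Rightarrow> real, K :: 'a set, \<delta> :: real) \<Rightarrow>
      case t of (\<psi>' :: 'a \<Rightarrow> real, K' :: 'a set, \<delta>' :: real) \<Rightarrow> \<delta>' \<le> \<delta> \<and> K \<inter> ball z0 \<delta>' = {})"
    for s t
  have ex: "\<exists>\<psi> K. P n (\<psi>, K, \<delta>)" if \<delta>: "\<delta> > 0" "\<delta> \<le> 1 / real (Suc n)" for n \<delta>
  proof -
    obtain \<psi> where \<psi>: "\<psi> \<in> Cc_inf (\<Omega> \<inter> ball z0 \<delta>)"
      "(\<integral>\<^sup>+x. ennreal (\<bar>\<psi> x\<bar> powr p) \<partial>m) \<le> ennreal ((1 / 2) ^ n)"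
      "(\<integral>\<^sup>+x. ennreal (excess x (grad \<psi> x) powr p) \<partial>m) \<le> ennreal ((1 / 2) ^ n)"
      "1 \<le> (\<integral>\<^sup>+x. ennreal (excess x (- grad \<psi> x) powr p) \<partial>m)"
      using tooth[OF p b z0(1) \<kappa> fwd bwd _ \<delta>(1), of "(1 / 2) ^ n"] by auto
    obtain K where K: "compact K" "K \<subseteq> \<Omega> \<inter> ball z0 \<delta>" "\<And>x. x \<notin> K \<Longrightarrow> \<psi> x = 0"
      using Cc_inf_support[OF \<psi>(1)] by blast
    have "\<psi> \<in> Cc_inf \<Omega>" using \<psi>(1) unfolding Cc_inf_def by blast
    then have "P n (\<psi>, K, \<delta>)" unfolding P_def using \<psi> K \<delta> by simp
    then show ?thesis by blast
  qed
  have "\<exists>t. P 0 t" using ex[of 1 0] by auto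
  moreover have "\<exists>t. P (Suc n) t \<and> Q s t" if s: "P n s" for n s
  proof -
    obtain \<psi> K \<delta> where s_eq: "s = (\<psi>, K, \<delta>)" by (cases s)
    have K: "compact K" "K \<subseteq> \<Omega>" "\<delta> > 0" using s by (auto simp: P_def s_eq)
    have "open (- K)" "z0 \<in> - K" using K z0(2) compact_imp_closed by auto
    then obtain r where r: "r > 0" "ball z0 r \<subseteq> - K" using openE by blast
    define \<delta>' where "\<delta>' = min \<delta> (min r (1 / real (Suc (Suc n))))"
    have "\<delta>' > 0" "\<delta>' \<le> 1 / real (Suc (Suc n))" using K(3) r(1) by (auto simp: \<delta>'_def)
    then obtain \<psi>' K' where "P (Suc n) (\<psi>', K', \<delta>')" using ex by blast
    moreover have "ball z0 \<delta>' \<subseteq> ball z0 r" by (rule subset_ball) (simp add: \<delta>'_def)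
    then have "Q s (\<psi>', K', \<delta>')" using r(2) by (auto simp: Q_def s_eq \<delta>'_def)
    ultimately show ?thesis by blast
  qed
  ultimately obtain t where t: "\<And>n. P n (t n)" "\<And>n. Q (t n) (t (Suc n))"
    using dependent_nat_choice[of P "\<lambda>_. Q"] by blast
  define \<psi> where "\<psi> n = fst (t n)" for n
  define K where "K n = fst (snd (t n))" for n
  define \<delta> where "\<delta> n = snd (snd (t n))" for n
  have t_eq: "t n = (\<psi> n, K n, \<delta> n)" for n by (simp add: \<psi>_def K_def \<delta>_def)
  have P: "\<psi> n \<in> Cc_inf \<Omega>" "compact (K n)" "K n \<subseteq> ball z0 (\<delta> n)" "x \<notin> K n \<Longrightarrow> \<psi> n x = 0"
     "\<delta> n \<le> 1 / real (Suc n)"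
     "(\<integral>\<^sup>+x. ennreal (\<bar>\<psi> n x\<bar> powr p) \<partial>m) \<le> ennreal ((1 / 2) ^ n)"
     "(\<integral>\<^sup>+x. ennreal (excess x (grad (\<psi> n) x) powr p) \<partial>m) \<le> ennreal ((1 / 2) ^ n)"
     "1 \<le> (\<integral>\<^sup>+x. ennreal (excess x (- grad (\<psi> n) x) powr p) \<partial>m)" for n x
    using t(1)[of n] unfolding P_def t_eq by auto
  have Q: "\<delta> (Suc n) \<le> \<delta> n" "K n \<inter> ball z0 (\<delta> (Suc n)) = {}" for n
    using t(2)[of n] unfolding Q_def t_eq by auto
  have less: "K i \<inter> K j = {}" if "i < j" for i j
  proof -
    have "\<delta> j \<le> \<delta> (Suc i)"
      by (rule lift_Suc_antimono_le[of \<delta>]) (use Q(1) that in auto)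
    then have "K j \<subseteq> ball z0 (\<delta> (Suc i))" by (rule order_trans[OF P(3) subset_ball])
    then show ?thesis using Q(2)[of i] by blast
  qed
  have "teeth \<Omega> F p \<psi> K"
  proof
    show "K i \<inter> K j = {}" if "i \<noteq> j" for i j
      using less[of i j] less[of j i] that by (cases "i < j") auto
    show "\<exists>N. \<forall>n\<ge>N. K n \<inter> L = {}" if L: "compact L" "L \<subseteq> \<Omega>" for L
    proof -
      have "open (- L)" "z0 \<in> - L" using L z0(2) compact_imp_closed by auto
      then obtain r where r: "r > 0" "ball z0 r \<subseteq> - L" using openE by blast
      \<comment> \<open>The radii tend to 0, whereas \<open>L\<close> keeps a positive distance from
        \<open>z0\<close>.\<close>
      obtain N where N: "1 / real (Suc N) < r" using nat_approx_posE[OF r(1)] .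
      have "K n \<inter> L = {}" if "n \<ge> N" for n
      proof -
        have "1 / real (Suc n) \<le> 1 / real (Suc N)" using that by (intro divide_left_mono) auto
        then have "\<delta> n \<le> r" using P(5)[of n] N by linarith
        then have "K n \<subseteq> ball z0 r" by (rule order_trans[OF P(3) subset_ball])
        then show ?thesis using r(2) by blast
      qed
      then show ?thesis by blast
    qed
  qed (use p P in auto)
  then show ?thesis by blast
qed

context teeth
begin

lemma \<psi>_C1: "C1 (\<psi> n)"
  using \<psi> by (rule Cc_inf_C1)

lemma grad_\<psi>_outside: "x \<notin> K n \<Longrightarrow> grad (\<psi> n) x = 0"
  by (rule grad_zero_outside[OF compact_imp_closed[OF K(1)] K(2)])

text \<open>The coefficients treat the limit, its remainders and their negatives alike: they will be
  1, \<open>tail k\<close> and the negatives of these.\<close>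

definition superpos :: "(nat \<Rightarrow> real) \<Rightarrow> 'a \<Rightarrow> real" where
  "superpos c x = (\<Sum>n. c n * \<psi> n x)"

definition superpos_grad :: "(nat \<Rightarrow> real) \<Rightarrow> 'a \<Rightarrow> 'a" where
  "superpos_grad c x = (\<Sum>n. c n *\<^sub>R grad (\<psi> n) x)"

lemma superpos_in: 
  assumes "x \<in> K n"
  shows "superpos c x = c n * \<psi> n x" "superpos_grad c x = c n *\<^sub>R grad (\<psi> n) x"
proof -
  have out: "x \<notin> K j" if "j \<notin> {n}" for j using disjoint[of n j] assms that by auto
  show "superpos c x = c n * \<psi> n x"
    unfolding superpos_def using suminf_finite[of "{n}" "\<lambda>n. c n * \<psi> n x"] K(2) out by simp
  show "superpos_grad c x = c n *\<^sub>R grad (\<psi> n) x"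
    unfolding superpos_grad_def
    using suminf_finite[of "{n}" "\<lambda>n. c n *\<^sub>R grad (\<psi> n) x"] grad_\<psi>_outside out by simp
qed

lemma superpos_out:
  assumes "\<And>n. x \<notin> K n"
  shows "superpos c x = 0" "superpos_grad c x = 0"
  unfolding superpos_def superpos_grad_def using K(2) grad_\<psi>_outside assms by simp_all

text \<open>On a compact subset of \<Omega> the series is a finite sum. Teeth whose
  \<open>K n\<close> misses that set have zero gradient there as well as zero value, so the termwise
  gradient agrees too.\<close>

lemma weak_grad_superpos: "weak_grad \<Omega> (superpos c) (superpos_grad c)"
proof (rule weak_grad_locally_C1)
  fix L assume "compact L" "L \<subseteq> \<Omega>"
  then obtain N where N: "\<And>n. n \<ge> N \<Longrightarrow> K n \<inter> L = {}" using locally_finite by blast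
  let ?f = "\<lambda>x. \<Sum>n<N. c n * \<psi> n x"
  have f: "C1 ?f" by (intro C1_sum C1_cmult \<psi>_C1)
  have "superpos c x = ?f x \<and> superpos_grad c x = grad ?f x" if x: "x \<in> L" for x
  proof -
    have out: "x \<notin> K n" if "n \<notin> {..<N}" for n using N[of n] that x by auto
    have "superpos c x = ?f x"
      unfolding superpos_def using out K(2) by (intro suminf_finite) auto
    moreover have "superpos_grad c x = (\<Sum>n<N. c n *\<^sub>R grad (\<psi> n) x)"
      unfolding superpos_grad_def using out grad_\<psi>_outside by (intro suminf_finite) auto
    ultimately show ?thesis by (simp add: grad_sum C1_cmult \<psi>_C1 grad_cmult)
  qed
  with f show "\<exists>f. C1 f \<and> (\<forall>x\<in>L. superpos c x = f x \<and> superpos_grad c x = grad f x)" by blast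
qed

definition tail :: "nat \<Rightarrow> nat \<Rightarrow> real" where
  "tail k n = (if k \<le> n then 1 else 0)"

definition partial :: "nat \<Rightarrow> 'a \<Rightarrow> real" where
  "partial k x = (\<Sum>n<k. \<psi> n x)"

lemma partial_Cc_inf: "partial k \<in> Cc_inf \<Omega>"
  unfolding partial_def[abs_def] by (intro Cc_inf_sum \<psi>)

lemma superpos_minus_partial: "superpos (\<lambda>_. 1) x - partial k x = superpos (tail k) x"
proof (cases "\<exists>n. x \<in> K n")
  case True
  then obtain n where n: "x \<in> K n" by blast
  have out: "x \<notin> K j" if "j \<noteq> n" for j using disjoint[of n j] n that by auto
  have "partial k x = (\<Sum>j<k. if j = n then \<psi> n x else 0)"
    unfolding partial_def using K(2) out by (intro sum.cong) auto
  then have "partial k x = (if n < k then \<psi> n x else 0)" by (simp add: sum.delta)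
  then show ?thesis by (simp add: superpos_in[OF n] tail_def)
next
  case False
  then show ?thesis using superpos_out[of x] K(2) by (simp add: partial_def)
qed

lemma superpos_uminus: "superpos (\<lambda>n. - c n) x = - superpos c x"
  using superpos_in[of x] superpos_out[of x] by (cases "\<exists>n. x \<in> K n") auto

text \<open>At each point at most one tooth is active, so the energy density is dominated by the
  series of the single densities from \<open>k\<close> on, whose integrals form a geometric series.
  The generic \<open>E\<close> and \<open>e\<close> cover both the values and the gradients.\<close>

lemma nn_integral_tail_le:
  fixes E :: "'a \<Rightarrow> real" and e :: "nat \<Rightarrow> 'a \<Rightarrow> real"
  assumes "\<And>x n. x \<in> K n \<Longrightarrow> E x = (if k \<le> n then e n x else 0)" "\<And>x. (\<And>n. x \<notin> K n) \<Longrightarrow> E x = 0"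
    and "\<And>n. e n \<in> borel_measurable borel"
    and "\<And>n. (\<integral>\<^sup>+x. ennreal (e n x) \<partial>m) \<le> ennreal ((1 / 2) ^ n)"
  shows "(\<integral>\<^sup>+x. ennreal (E x) \<partial>m) \<le> ennreal (2 * (1 / 2) ^ k)"
proof -
  have "ennreal (E x) \<le> (\<Sum>i. ennreal (e (i + k) x))" for x
  proof (cases "\<exists>n\<ge>k. x \<in> K n")
    case True
    then obtain n where n: "n \<ge> k" "x \<in> K n" by blast
    then have "ennreal (E x) = (\<Sum>i\<in>{n - k}. ennreal (e (i + k) x))" using assms(1) by simp
    also have "\<dots> \<le> (\<Sum>i. ennreal (e (i + k) x))" by (intro sum_le_suminf) auto
    finally show ?thesis .
  next
    case False
    then have "E x = 0" using assms(1,2)[of x] by (metis (full_types))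
    then show ?thesis by simp
  qed
  then have "(\<integral>\<^sup>+x. ennreal (E x) \<partial>m) \<le> (\<integral>\<^sup>+x. (\<Sum>i. ennreal (e (i + k) x)) \<partial>m)"
    by (intro nn_integral_mono)
  also have "\<dots> = (\<Sum>i. \<integral>\<^sup>+x. ennreal (e (i + k) x) \<partial>m)"
    using assms(3) by (intro nn_integral_suminf) simp
  also have "\<dots> \<le> (\<Sum>i. ennreal ((1 / 2) ^ (i + k)))"
    by (intro suminf_le assms(4)) auto
  also have "\<dots> = ennreal (2 * (1 / 2) ^ k)"
  proof (rule suminf_ennreal_eq)
    show "(\<lambda>i. (1 / 2 :: real) ^ (i + k)) sums (2 * (1 / 2) ^ k)"
      using sums_mult2[OF geometric_sums[of "1 / 2 :: real"], of "(1 / 2) ^ k"] by (simp add: power_add)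
  qed simp
  finally show ?thesis .
qed

lemma sobolev_norm_tail_le:
  "sobolev_norm \<Omega> F m p (superpos (tail k)) \<le> ennreal (2 * (2 * (1 / 2) ^ k) powr (1 / p))"
proof -
  let ?r = "2 * (1 / 2 :: real) ^ k"
  have "(\<integral>\<^sup>+x. ennreal (\<bar>superpos (tail k) x\<bar> powr p) \<partial>m) \<le> ennreal ?r"
  proof (rule nn_integral_tail_le[where e = "\<lambda>n x. \<bar>\<psi> n x\<bar> powr p"])
    have [measurable]: "\<psi> n \<in> borel_measurable borel" for n
      by (intro borel_measurable_continuous_onI C1_continuous \<psi>_C1)
    show "(\<lambda>x. \<bar>\<psi> n x\<bar> powr p) \<in> borel_measurable borel" for n by measurable
  qed (use p in \<open>auto simp: superpos_in superpos_out tail_def energy_0\<close>)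
  moreover have "(\<integral>\<^sup>+x. ennreal (excess x (superpos_grad (tail k) x) powr p) \<partial>m) \<le> ennreal ?r"
  proof (rule nn_integral_tail_le[where e = "\<lambda>n x. excess x (grad (\<psi> n) x) powr p"])
    have [measurable]: "grad (\<psi> n) \<in> borel_measurable borel" for n
      by (intro borel_measurable_continuous_onI grad_continuous \<psi>_C1)
    show "(\<lambda>x. excess x (grad (\<psi> n) x) powr p) \<in> borel_measurable borel" for n by measurable
  qed (use p in \<open>auto simp: superpos_in superpos_out tail_def energy_forward excess_zero\<close>)
  moreover have "enn_root p I \<le> ennreal (?r powr (1 / p))" if I: "I \<le> ennreal ?r" for I
  proof -
    have "I < \<infinity>" using I by (simp add: le_less_trans)
    moreover have "enn2real I \<le> ?r" using enn2real_mono[OF I] by simp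
    ultimately show ?thesis
      using p by (auto simp: enn_root_def intro!: ennreal_leI powr_mono2)
  qed
  ultimately have "sobolev_norm \<Omega> F m p (superpos (tail k)) \<le> ennreal (?r powr (1 / p)) + ennreal (?r powr (1 / p))"
    unfolding sobolev_norm_eq[OF weak_grad_superpos] by (intro add_mono)
  then show ?thesis by (simp flip: ennreal_plus)
qed

lemma tendsto_sobolev_norm_tail: "(\<lambda>k. sobolev_norm \<Omega> F m p (superpos (tail k))) \<longlonglongrightarrow> 0"
proof (rule tendsto_sandwich[where f = "\<lambda>_. 0" and h = "\<lambda>k. ennreal (2 * (2 * (1 / 2) ^ k) powr (1 / p))"])
  have "(\<lambda>k. 2 * (2 * (1 / 2 :: real) ^ k) powr (1 / p)) \<longlonglongrightarrow> 2 * (2 * 0) powr (1 / p)"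
    using p by (intro tendsto_mult tendsto_const tendsto_powr' LIMSEQ_power_zero) auto
  then have "(\<lambda>k. ennreal (2 * (2 * (1 / 2) ^ k) powr (1 / p))) \<longlonglongrightarrow> ennreal 0"
    by (intro tendsto_ennrealI) simp
  then show "(\<lambda>k. ennreal (2 * (2 * (1 / 2) ^ k) powr (1 / p))) \<longlonglongrightarrow> 0" by simp
qed (auto simp: sobolev_norm_tail_le)

text \<open>Each reversed tooth from \<open>N\<close> on contributes at least 1, on disjoint sets,
  so the energy exceeds every natural number. Only the gradient on late teeth is prescribed, which
  leaves room for a perturbation by a test function.\<close>

lemma sobolev_norm_backward_infinite:
  assumes G: "weak_grad \<Omega> v G" and N: "\<And>n x. n \<ge> N \<Longrightarrow> x \<in> K n \<Longrightarrow> G x = - grad (\<psi> n) x"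
  shows "sobolev_norm \<Omega> F m p v = \<infinity>"
proof -
  let ?e = "\<lambda>n x. excess x (- grad (\<psi> n) x) powr p"
  have [measurable]: "grad (\<psi> n) \<in> borel_measurable borel" for n
    by (intro borel_measurable_continuous_onI grad_continuous \<psi>_C1)
  have "of_nat j \<le> (\<integral>\<^sup>+x. ennreal (excess x (G x) powr p) \<partial>m)" for j
  proof -
    have "of_nat j = (\<Sum>n\<in>{N..<N+j}. (1 :: ennreal))" by simp
    also have "\<dots> \<le> (\<Sum>n\<in>{N..<N+j}. \<integral>\<^sup>+x. ennreal (?e n x) \<partial>m)"
      by (intro sum_mono energy_backward)
    also have "\<dots> = (\<integral>\<^sup>+x. (\<Sum>n\<in>{N..<N+j}. ennreal (?e n x)) \<partial>m)"
      by (intro nn_integral_sum[symmetric]) measurable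
    also have "\<dots> \<le> (\<integral>\<^sup>+x. ennreal (excess x (G x) powr p) \<partial>m)"
    proof (rule nn_integral_mono)
      fix x
      have zero: "?e n x = 0" if "x \<notin> K n" for n
        using grad_\<psi>_outside[OF that] by (simp add: excess_zero)
      show "(\<Sum>n\<in>{N..<N+j}. ennreal (?e n x)) \<le> ennreal (excess x (G x) powr p)"
      proof (cases "\<exists>n\<in>{N..<N+j}. x \<in> K n")
        case True
        then obtain n where n: "n \<in> {N..<N+j}" "x \<in> K n" by blast
        have out: "x \<notin> K i" if "i \<noteq> n" for i using disjoint[of n i] n(2) that by auto
        have "(\<Sum>i\<in>{N..<N+j}. ennreal (?e i x)) = (\<Sum>i\<in>{N..<N+j}. if i = n then ennreal (?e n x) else 0)"
          using zero out by (intro sum.cong) auto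
        then show ?thesis using n N[of n x] by (simp add: sum.delta)
      next
        case False
        then have "(\<Sum>n\<in>{N..<N+j}. ennreal (?e n x)) = 0" using zero by (intro sum.neutral) auto
        then show ?thesis by simp
      qed
    qed
    finally show ?thesis .
  qed
  then have "(\<integral>\<^sup>+x. ennreal (excess x (G x) powr p) \<partial>m) = \<infinity>"
    by (metis ennreal_Ex_less_of_nat infinity_ennreal_def leD less_top)
  then show ?thesis by (simp add: sobolev_norm_eq[OF G] enn_root_def)
qed

section \<open>Failure of the vector space property and of the symmetry of the topologies\<close>

abbreviation (input) "limit \<equiv> superpos (\<lambda>_. 1)"

lemma sobolev_norm_zero: "sobolev_norm \<Omega> F m p (\<lambda>x. 0) = 0"
proof -
  have "weak_grad \<Omega> (\<lambda>x. 0) (\<lambda>x. 0)"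
    by (rule weak_grad_locally_C1) (auto intro!: exI[of _ "\<lambda>x. 0"] C1_const simp: grad_const)
  from sobolev_norm_eq[OF this, of p] show ?thesis
    using p by (simp add: excess_zero enn_root_def)
qed

lemma Cc_inf_subset_W1p0: "\<phi> \<in> Cc_inf \<Omega> \<Longrightarrow> \<phi> \<in> W1p0 \<Omega> F m p"
  unfolding W1p0_def by (auto intro!: exI[of _ "\<lambda>_. \<phi>"] simp: sobolev_norm_zero)

lemma tendsto_forward: "(\<lambda>k. sobolev_norm \<Omega> F m p (\<lambda>x. limit x - partial k x)) \<longlonglongrightarrow> 0"
  unfolding superpos_minus_partial using tendsto_sobolev_norm_tail by simp

lemma limit_in_W1p0: "limit \<in> W1p0 \<Omega> F m p"
  unfolding W1p0_def using tendsto_forward partial_Cc_inf by blast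

lemma backward_infinite: "sobolev_norm \<Omega> F m p (\<lambda>x. partial k x - limit x) = \<infinity>"
proof -
  have "(\<lambda>x. partial k x - limit x) = superpos (\<lambda>n. - tail k n)"
    using superpos_minus_partial[of _ k] by (simp add: fun_eq_iff superpos_uminus) (metis minus_diff_eq)
  moreover have "sobolev_norm \<Omega> F m p (superpos (\<lambda>n. - tail k n)) = \<infinity>"
    by (rule sobolev_norm_backward_infinite[OF weak_grad_superpos, of k]) (simp add: superpos_in tail_def)
  ultimately show ?thesis by simp
qed

text \<open>The support of a test function meets only finitely many teeth, so subtracting it leaves
  infinitely many reversed teeth intact and the difference has infinite norm. The factor
  \<open>- 1\<close> is the scalar that refutes closure under multiples.\<close>

lemma minus_limit_not_in_W1p0: "(\<lambda>x. - 1 * limit x) \<notin> W1p0 \<Omega> F m p"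
proof
  assume "(\<lambda>x. - 1 * limit x) \<in> W1p0 \<Omega> F m p"
  then obtain \<phi> where \<phi>: "\<And>k. \<phi> k \<in> Cc_inf \<Omega>"
    "(\<lambda>k. sobolev_norm \<Omega> F m p (\<lambda>x. - 1 * limit x - \<phi> k x)) \<longlonglongrightarrow> 0"
    unfolding W1p0_def by blast
  have "\<forall>\<^sub>F k in sequentially. sobolev_norm \<Omega> F m p (\<lambda>x. - 1 * limit x - \<phi> k x) < \<infinity>"
    using order_tendstoD(2)[OF \<phi>(2), of \<infinity>] by simp
  then obtain k where k: "sobolev_norm \<Omega> F m p (\<lambda>x. - 1 * limit x - \<phi> k x) < \<infinity>"
    by (auto dest: eventually_happens)
  obtain L where L: "compact L" "L \<subseteq> \<Omega>" "\<And>x. x \<notin> L \<Longrightarrow> \<phi> k x = 0"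
    using Cc_inf_support[OF \<phi>(1)] by blast
  obtain N where N: "\<And>n. n \<ge> N \<Longrightarrow> K n \<inter> L = {}" using locally_finite[OF L(1,2)] by blast
  have C1: "C1 (\<phi> k)" by (rule Cc_inf_C1[OF \<phi>(1)])
  have "weak_grad \<Omega> (\<lambda>x. - 1 * \<phi> k x) (\<lambda>x. - 1 *\<^sub>R grad (\<phi> k) x)"
    by (rule weak_grad_locally_C1)
       (use C1_cmult[OF C1, of "- 1"] grad_cmult[OF C1, of "- 1"] in \<open>blast intro: sym\<close>)
  from weak_grad_add[OF weak_grad_superpos[of "\<lambda>n. - 1"] this]
  have "weak_grad \<Omega> (\<lambda>x. - 1 * limit x - \<phi> k x) (\<lambda>x. superpos_grad (\<lambda>n. - 1) x - grad (\<phi> k) x)"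
    using superpos_uminus[of "\<lambda>n. 1"] by simp
  then have "sobolev_norm \<Omega> F m p (\<lambda>x. - 1 * limit x - \<phi> k x) = \<infinity>"
  proof (rule sobolev_norm_backward_infinite)
    fix n x assume n: "n \<ge> N" "x \<in> K n"
    then have "x \<notin> L" using N by blast
    then have "grad (\<phi> k) x = 0"
      using grad_zero_outside[OF compact_imp_closed[OF L(1)], of "\<phi> k"] L(3) by blast
    then show "superpos_grad (\<lambda>n. - 1) x - grad (\<phi> k) x = - grad (\<psi> n) x"
      by (simp add: superpos_in[OF n(2)])
  qed
  with k show False by simp
qed

lemma topologies_differ:
  "forward_open (W1p0 \<Omega> F m p) (sob_dist \<Omega> F m p) \<noteq> backward_open (W1p0 \<Omega> F m p) (sob_dist \<Omega> F m p)"
proof -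
  let ?W = "W1p0 \<Omega> F m p" and ?D = "sob_dist \<Omega> F m p"
  \<comment> \<open>The separating set: finiteness of forward distance survives steps of forward
    length less than 1. But the partial sums enter every backward ball around the limit, although
    their forward distance from it is infinite.\<close>
  define S where "S = {v \<in> ?W. ?D limit v < \<infinity>}"
  have "forward_open ?W ?D S"
    unfolding forward_open_def
  proof (intro conjI ballI)
    show "S \<subseteq> ?W" by (auto simp: S_def)
    fix v assume v: "v \<in> S"
    have "{w \<in> ?W. ?D v w < 1} \<subseteq> S"
    proof
      fix w assume w: "w \<in> {w \<in> ?W. ?D v w < 1}"
      then have fin: "sobolev_norm \<Omega> F m p (\<lambda>x. w x - v x) < \<infinity>"
        by (auto simp: sob_dist_def intro: less_trans)
      have "sobolev_norm \<Omega> F m p (\<lambda>x. v x - limit x) < \<infinity>"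
        using v by (simp add: S_def sob_dist_def)
      then have "sobolev_norm \<Omega> F m p (\<lambda>x. (w x - v x) + (v x - limit x)) < \<infinity>"
        using p fin by (intro sobolev_norm_add_finite) auto
      then show "w \<in> S" using w by (simp add: S_def sob_dist_def)
    qed
    then show "\<exists>R>0. {w \<in> ?W. ?D v w < R} \<subseteq> S" by (intro exI[of _ 1]) simp
  qed
  moreover have "\<not> backward_open ?W ?D S"
  proof
    assume "backward_open ?W ?D S"
    moreover have "limit \<in> S"
      using limit_in_W1p0 by (simp add: S_def sob_dist_def sobolev_norm_zero)
    ultimately obtain R where R: "R > 0" "{v \<in> ?W. ?D v limit < R} \<subseteq> S"
      unfolding backward_open_def by blast
    have "\<forall>\<^sub>F k in sequentially. ?D (partial k) limit < R"
      unfolding sob_dist_def using order_tendstoD(2)[OF tendsto_forward R(1)] .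
    then obtain k where "?D (partial k) limit < R" by (auto dest: eventually_happens)
    then have "partial k \<in> S"
      using R(2) Cc_inf_subset_W1p0[OF partial_Cc_inf] by blast
    then show False by (simp add: S_def sob_dist_def backward_infinite)
  qed
  ultimately show ?thesis by metis
qed

end

theorem theorem4p9:
  fixes \<Omega> :: "'a::euclidean_space set" and F :: "'a \<Rightarrow> 'a \<Rightarrow> real"
  assumes "DIM('a) \<ge> 2"
    and "funk_metric_space \<Omega> F"
  shows "\<forall>p::real. p > 1 \<longrightarrow>
      (let m = BH_measure \<Omega> F; W = W1p0 \<Omega> F m p; D = sob_dist \<Omega> F m p in
         \<not> (\<forall>u\<in>W. \<forall>v\<in>W. \<forall>c::real. (\<lambda>x. u x + v x) \<in> W \<and> (\<lambda>x. c * u x) \<in> W)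
       \<and> forward_open W D \<noteq> backward_open W D
       \<and> (\<exists>uk u. (\<forall>k. uk k \<in> W) \<and> u \<in> W
            \<and> ((\<lambda>k. sobolev_norm \<Omega> F m p (\<lambda>x. u x - uk k x)) \<longlonglongrightarrow> 0)
            \<and> (\<forall>k. sobolev_norm \<Omega> F m p (\<lambda>x. uk k x - u x) = \<infinity>)))"
proof (intro allI impI)
  fix p :: real assume p: "p > 1"
  interpret funk_space \<Omega> F by unfold_locales (rule assms(2))
  obtain \<psi> K where "teeth \<Omega> F p \<psi> K" using teeth_exist[OF p] by blast
  then interpret teeth \<Omega> F p \<psi> K .
  show "let m = BH_measure \<Omega> F; W = W1p0 \<Omega> F m p; D = sob_dist \<Omega> F m p in
         \<not> (\<forall>u\<in>W. \<forall>v\<in>W. \<forall>c::real. (\<lambda>x. u x + v x) \<in> W \<and> (\<lambda>x. c * u x) \<in> W)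
       \<and> forward_open W D \<noteq> backward_open W D
       \<and> (\<exists>uk u. (\<forall>k. uk k \<in> W) \<and> u \<in> W
            \<and> ((\<lambda>k. sobolev_norm \<Omega> F m p (\<lambda>x. u x - uk k x)) \<longlonglongrightarrow> 0)
            \<and> (\<forall>k. sobolev_norm \<Omega> F m p (\<lambda>x. uk k x - u x) = \<infinity>))"
    unfolding Let_def m_def[symmetric]
  proof (intro conjI)
    show "\<not> (\<forall>u\<in>W1p0 \<Omega> F m p. \<forall>v\<in>W1p0 \<Omega> F m p. \<forall>c.
        (\<lambda>x. u x + v x) \<in> W1p0 \<Omega> F m p \<and> (\<lambda>x. c * u x) \<in> W1p0 \<Omega> F m p)"
      using limit_in_W1p0 minus_limit_not_in_W1p0 by blast
    show "forward_open (W1p0 \<Omega> F m p) (sob_dist \<Omega> F m p) \<noteq> backward_open (W1p0 \<Omega> F m p) (sob_dist \<Omega> F m p)"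
      by (rule topologies_differ)
    show "\<exists>uk u. (\<forall>k. uk k \<in> W1p0 \<Omega> F m p) \<and> u \<in> W1p0 \<Omega> F m p
            \<and> ((\<lambda>k. sobolev_norm \<Omega> F m p (\<lambda>x. u x - uk k x)) \<longlonglongrightarrow> 0)
            \<and> (\<forall>k. sobolev_norm \<Omega> F m p (\<lambda>x. uk k x - u x) = \<infinity>)"
      using Cc_inf_subset_W1p0[OF partial_Cc_inf] limit_in_W1p0 tendsto_forward backward_infinite
      by (intro exI[of _ partial] exI[of _ "superpos (\<lambda>_. 1)"]) auto
  qed
qed

end
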